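(* Let the generalized $\phi$-divergence $\Phi=\mathcal{V}^*$ be defined using a risk-averse expected disutility function $\mathcal{V}$, let $\varepsilon\ge0$ and $M_N\in\mathcal{M}$, and let $$\mathcal{R}^\varepsilon(X):=\inf_{\lambda>0}\{\lambda\varepsilon+\mathcal{R}_\lambda(X)\},\qquad \mathcal{R}_\lambda(X):=\lambda\mathcal{R}(\lambda^{-1}X)=\min_{t\in\mathbb{R}}\{t+\lambda\mathcal{V}(\lambda^{-1}(X-t))\},\qquad X\in\mathcal{M},$$ where $\mathcal{R}(X):=\min_{t\in\mathbb{R}}\{t+\mathcal{V}(X-t)\}$ is the risk measure projected from $\mathcal{V}$. Then the coherent generalized variational inference (CGVI) problem is given by $$\mathcal{R}^\varepsilon(M_N)=\sup_{p\in\mathfrak{D}_\varepsilon}\mathbb{E}[pM_N]=\min_{\mu\in\mathbb{R},\,\lambda\ge0}\{\mu+\lambda\varepsilon+(\lambda\Phi)^*(M_N-\mu)\},$$ and a variational density (a maximizer $p\in\mathfrak{D}_\varepsilon$ of $\mathbb{E}[pM_N]$) exists if and only if $$\partial\mathcal{R}^\varepsilon(M_N)\cap\mathcal{L}\neq\emptyset.$$ Moreover, the variational densities are given by $$\bar p\in\partial\mathcal{V}(\bar\lambda^{-1}(M_N-\bar\mu))\cap\{p\in\mathcal{L}\;:\;\mathbb{E}[p]=1\},$$ where $(\bar\mu,\bar\lambda)$ solve the minimization problem over $\mu\in\mathbb{R}$, $\lambda\ge0$ displayed above.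
   Context: $(\Theta,\mathcal{B},\Pi)$ is a complete probability space and $\mathbb{E}$ is expectation with respect to $\Pi$. $\mathcal{L}$ and $\mathcal{M}$ are Banach spaces of $\mathcal{B}$-measurable functions $\Theta\to\mathbb{R}$, both containing all simple functions, such that $\mathbb{E}[|pX|]<\infty$ for all $p\in\mathcal{L}$, $X\in\mathcal{M}$. They are paired by $\langle p,X\rangle=\mathbb{E}[pX]$; through this pairing $\mathcal{L}$ is identified with a subspace of the topological dual $\mathcal{M}^*$ and $\mathcal{M}$ with a subspace of $\mathcal{L}^*$, and it is assumed that $\mathcal{L}=\mathcal{M}^*$ or $\mathcal{M}=\mathcal{L}^*$. $\sigma(\mathcal{M},\mathcal{L})$ denotes the weak topology on $\mathcal{M}$ induced by $\mathcal{L}$. $\mathcal{V}:\mathcal{M}\to[-\infty,+\infty]$ is a risk-averse expected disutility function if: (V1) $\mathcal{V}$ is proper, $\sigma(\mathcal{M},\mathcal{L})$-lower semicontinuous and convex; (V2) for any $X\in\mathcal{M}$, $\mathcal{V}(X)\ge\mathbb{E}[X]$, and $\mathcal{V}(X)=\mathbb{E}[X]$ implies $X\equiv0$; moreover $\mathcal{V}(0)=0$; (V3) if $X,X'\in\mathcal{M}$ satisfy $X\le X'$ a.s., then $\mathcal{V}(X)\le\mathcal{V}(X')$. $\Phi(p)=\mathcal{V}^*(p)=\sup_{X\in\mathcal{M}}\{\mathbb{E}[pX]-\mathcal{V}(X)\}$ for $p\in\mathcal{L}$. $\mathfrak{D}$ is the set of $\mathcal{B}$-measurable $p:\Theta\to[0,\infty]$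 with $\mathbb{E}[p]=1$, and $\mathfrak{D}_\varepsilon=\{p\in\mathfrak{D}:\Phi(p)\le\varepsilon\}$, where $\Phi=+\infty$ for densities not in $\mathcal{L}$. For $\lambda\ge0$, $(\lambda\Phi)^*$ is the Fenchel conjugate of $\lambda\Phi$, i.e. $(\lambda\Phi)^*(X)=\sup_{p\in\mathcal{L}}\{\mathbb{E}[pX]-\lambda\Phi(p)\}$ for $X\in\mathcal{M}$, where $0\cdot(+\infty)=+\infty$. $M_N(\theta)=\frac1N\sum_{n=1}^N m(\theta,y_n)$ is the pay-off function for fixed data $y_1,\dots,y_N$ in a data space $\Upsilon$ and a function $m:\Theta\times\Upsilon\to\mathbb{R}$. For convex $f$ on $\mathcal{M}$, $\partial f(x)=\{\eta\in\mathcal{M}^*: f(x')-f(x)\ge\langle\eta,x'-x\rangle\ \forall x'\in\mathcal{M}\}$ is the convex subdifferential.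
   Formalization: For ε=0 the equality R^ε=sup and attainment of the min are not asserted (they can fail); the iff and the formula are then given only if R^0=sup. Variational densities are the p in ∂V(...)∩{E[p]=1} that also satisfy Φ(p)=ε, for solutions with λ̄>0 only. *)

theory Defs
  imports "HOL-Analysis.Analysis" "HOL-Probability.Probability_Measure"
begin

section \<open>Paired Banach function spaces\<close>

text \<open>
  A Banach space of measurable functions consists of classes modulo almost sure equality. It is
  given by a type of class \<open>banach\<close> (with its own norm) together with a map \<open>emb\<close> that picks a
  representative of each element.
\<close>

locale banach_function_space =
  fixes P :: "'a measure" and emb :: "'b::banach \<Rightarrow> 'a \<Rightarrow> real"
  assumes emb_measurable: "emb X \<in> borel_measurable P"
    and emb_add: "AE \<theta> in P. emb (X + Y) \<theta> = emb X \<theta> + emb Y \<theta>"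
    and emb_scaleR: "AE \<theta> in P. emb (c *\<^sub>R X) \<theta> = c * emb X \<theta>"
    and emb_inj: "(AE \<theta> in P. emb X \<theta> = emb Y \<theta>) \<Longrightarrow> X = Y"
    and emb_simple: "simple_function P s \<Longrightarrow> \<exists>X. AE \<theta> in P. emb X \<theta> = s \<theta>"

definition const_elem :: "'a measure \<Rightarrow> ('b \<Rightarrow> 'a \<Rightarrow> real) \<Rightarrow> real \<Rightarrow> 'b" where
  "const_elem P emb t = (THE X. AE \<theta> in P. emb X \<theta> = t)"

lemma (in banach_function_space) const_elem: "AE \<theta> in P. emb (const_elem P emb t) \<theta> = t"
proof -
  obtain X where X: "AE \<theta> in P. emb X \<theta> = t"
    using emb_simple[of "\<lambda>_. t"] by auto
  have "Y = X" if "AE \<theta> in P. emb Y \<theta> = t" for Y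
    by (rule emb_inj) (use X that in eventually_elim, simp)
  with X show ?thesis
    unfolding const_elem_def by (rule theI[where P = "\<lambda>X. AE \<theta> in P. emb X \<theta> = t"])
qed

definition expect :: "'a measure \<Rightarrow> ('b \<Rightarrow> 'a \<Rightarrow> real) \<Rightarrow> 'b \<Rightarrow> real" where
  "expect P emb X = (\<integral>\<theta>. emb X \<theta> \<partial>P)"

definition pairing ::
    "'a measure \<Rightarrow> ('l \<Rightarrow> 'a \<Rightarrow> real) \<Rightarrow> ('m \<Rightarrow> 'a \<Rightarrow> real) \<Rightarrow> 'l \<Rightarrow> 'm \<Rightarrow> real" where
  "pairing P embL embM p X = (\<integral>\<theta>. embL p \<theta> * embM X \<theta> \<partial>P)"

text \<open>
  The two continuity assumptions say that the pairing maps each space into the topological dual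
  of the other; the last assumption says that at least one of these maps is onto.
\<close>

locale paired_spaces =
  prob_space P + complete_measure P +
  L: banach_function_space P embL + M: banach_function_space P embM
  for P :: "'a measure" and embL :: "'l::banach \<Rightarrow> 'a \<Rightarrow> real" and embM :: "'m::banach \<Rightarrow> 'a \<Rightarrow> real" +
  assumes pairing_integrable: "integrable P (\<lambda>\<theta>. embL p \<theta> * embM X \<theta>)"
    and pairing_dual_M: "bounded_linear (\<lambda>X. pairing P embL embM p X)"
    and pairing_dual_L: "bounded_linear (\<lambda>p. pairing P embL embM p X)"
    and pairing_onto:
      "(\<forall>\<eta> :: 'm \<Rightarrow>\<^sub>L real. \<exists>p. \<forall>X. blinfun_apply \<eta> X = pairing P embL embM p X) \<or>
       (\<forall>\<xi> :: 'l \<Rightarrow>\<^sub>L real. \<exists>X. \<forall>p. blinfun_apply \<xi> p = pairing P embL embM p X)"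

definition to_dual ::
    "'a measure \<Rightarrow> ('l \<Rightarrow> 'a \<Rightarrow> real) \<Rightarrow> ('m::banach \<Rightarrow> 'a \<Rightarrow> real) \<Rightarrow> 'l \<Rightarrow> ('m \<Rightarrow>\<^sub>L real)" where
  "to_dual P embL embM p = Blinfun (pairing P embL embM p)"

definition weak_top ::
    "'a measure \<Rightarrow> ('l \<Rightarrow> 'a \<Rightarrow> real) \<Rightarrow> ('m \<Rightarrow> 'a \<Rightarrow> real) \<Rightarrow> 'm topology" where
  "weak_top P embL embM =
     topology_generated_by {{X. pairing P embL embM p X \<in> U} | p U. open U}"

section \<open>Convex analysis for extended real valued functions\<close>

definition proper :: "('b \<Rightarrow> ereal) \<Rightarrow> bool" where
  "proper f \<longleftrightarrow> (\<forall>x. f x \<noteq> -\<infinity>) \<and> (\<exists>x. f x \<noteq> \<infinity>)"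

definition lsc_in :: "'b topology \<Rightarrow> ('b \<Rightarrow> ereal) \<Rightarrow> bool" where
  "lsc_in T f \<longleftrightarrow> (\<forall>c. openin T {x \<in> topspace T. c < f x})"

text \<open>Convexity is convexity of the epigraph, so that no undefined extended sums occur.\<close>

definition convex_ereal :: "('b::real_vector \<Rightarrow> ereal) \<Rightarrow> bool" where
  "convex_ereal f \<longleftrightarrow> convex {(x, r :: real). f x \<le> ereal r}"

text \<open>
  On \<^typ>\<open>ereal\<close>, \<open>\<infinity> - \<infinity> = \<infinity>\<close>; hence for a proper \<open>f\<close> the set below is empty at points where
  \<open>f\<close> is \<open>\<infinity>\<close>, as usual.
\<close>

definition subdifferential ::
    "('m::real_normed_vector \<Rightarrow> ereal) \<Rightarrow> 'm \<Rightarrow> ('m \<Rightarrow>\<^sub>L real) set" where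
  "subdifferential f x = {\<eta>. \<forall>x'. f x' - f x \<ge> ereal (blinfun_apply \<eta> (x' - x))}"

text \<open>\<open>scale_conv \<lambda> f\<close> is \<open>\<lambda> f\<close> with the convention \<open>0 \<cdot> \<infinity> = \<infinity>\<close> (on \<^typ>\<open>ereal\<close>, \<open>0 * \<infinity> = 0\<close>).\<close>

definition scale_conv :: "real \<Rightarrow> ('b \<Rightarrow> ereal) \<Rightarrow> 'b \<Rightarrow> ereal" where
  "scale_conv lam f p = (if f p = \<infinity> then \<infinity> else ereal lam * f p)"

section \<open>Disutility, divergence and risk measures\<close>

locale risk_averse_disutility = paired_spaces P embL embM
  for P :: "'a measure" and embL :: "'l::banach \<Rightarrow> 'a \<Rightarrow> real" and embM :: "'m::banach \<Rightarrow> 'a \<Rightarrow> real" +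
  fixes V :: "'m \<Rightarrow> ereal"
  assumes V_proper: "proper V"
    and V_lsc: "lsc_in (weak_top P embL embM) V"
    and V_convex: "convex_ereal V"
    and V_ge: "V X \<ge> ereal (expect P embM X)"
    and V_eq: "V X = ereal (expect P embM X) \<Longrightarrow> X = 0"
    and V_zero: "V 0 = 0"
    and V_mono: "(AE \<theta> in P. embM X \<theta> \<le> embM X' \<theta>) \<Longrightarrow> V X \<le> V X'"

definition divergence ::
    "'a measure \<Rightarrow> ('l \<Rightarrow> 'a \<Rightarrow> real) \<Rightarrow> ('m \<Rightarrow> 'a \<Rightarrow> real) \<Rightarrow> ('m \<Rightarrow> ereal) \<Rightarrow> 'l \<Rightarrow> ereal" where
  "divergence P embL embM V p = (SUP X. ereal (pairing P embL embM p X) - V X)"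

definition conjugate_L ::
    "'a measure \<Rightarrow> ('l \<Rightarrow> 'a \<Rightarrow> real) \<Rightarrow> ('m \<Rightarrow> 'a \<Rightarrow> real) \<Rightarrow> ('l \<Rightarrow> ereal) \<Rightarrow> 'm \<Rightarrow> ereal" where
  "conjugate_L P embL embM f X = (SUP p. ereal (pairing P embL embM p X) - f p)"

definition densities :: "'a measure \<Rightarrow> ('a \<Rightarrow> ennreal) set" where
  "densities P = {d \<in> borel_measurable P. (\<integral>\<^sup>+\<theta>. d \<theta> \<partial>P) = 1}"

text \<open>
  The densities of divergence at most \<open>\<epsilon>\<close>. The divergence of a density outside the space with
  embedding \<open>embL\<close> is \<open>\<infinity>\<close>, so only elements \<open>p\<close> of that space occur.
\<close>

definition density_ball ::
    "'a measure \<Rightarrow> ('l \<Rightarrow> 'a \<Rightarrow> real) \<Rightarrow> ('m \<Rightarrow> 'a \<Rightarrow> real) \<Rightarrow> ('m \<Rightarrow> ereal) \<Rightarrow> real \<Rightarrow> 'l set" where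
  "density_ball P embL embM V \<epsilon> =
     {p. (\<exists>d \<in> densities P. AE \<theta> in P. enn2ereal (d \<theta>) = ereal (embL p \<theta>)) \<and>
         divergence P embL embM V p \<le> ereal \<epsilon>}"

definition regret ::
    "'a measure \<Rightarrow> ('m::real_vector \<Rightarrow> 'a \<Rightarrow> real) \<Rightarrow> ('m \<Rightarrow> ereal) \<Rightarrow> real \<Rightarrow> 'm \<Rightarrow> real \<Rightarrow> ereal" where
  "regret P embM V lam X t =
     ereal t + ereal lam * V (inverse lam *\<^sub>R (X - const_elem P embM t))"

definition risk ::
    "'a measure \<Rightarrow> ('m::real_vector \<Rightarrow> 'a \<Rightarrow> real) \<Rightarrow> ('m \<Rightarrow> ereal) \<Rightarrow> 'm \<Rightarrow> ereal" where
  "risk P embM V X = (INF t. ereal t + V (X - const_elem P embM t))"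

definition risk_scaled ::
    "'a measure \<Rightarrow> ('m::real_vector \<Rightarrow> 'a \<Rightarrow> real) \<Rightarrow> ('m \<Rightarrow> ereal) \<Rightarrow> real \<Rightarrow> 'm \<Rightarrow> ereal" where
  "risk_scaled P embM V lam X = ereal lam * risk P embM V (inverse lam *\<^sub>R X)"

definition risk_eps ::
    "'a measure \<Rightarrow> ('m::real_vector \<Rightarrow> 'a \<Rightarrow> real) \<Rightarrow> ('m \<Rightarrow> ereal) \<Rightarrow> real \<Rightarrow> 'm \<Rightarrow> ereal" where
  "risk_eps P embM V \<epsilon> X = (INF lam \<in> {0<..}. ereal (lam * \<epsilon>) + risk_scaled P embM V lam X)"

section \<open>Coherent generalized variational inference\<close>

definition payoff :: "('a \<Rightarrow> 'y \<Rightarrow> real) \<Rightarrow> (nat \<Rightarrow> 'y) \<Rightarrow> nat \<Rightarrow> 'a \<Rightarrow> real" where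
  "payoff m y N \<theta> = (1 / real N) * (\<Sum>n = 1..N. m \<theta> (y n))"

definition dual_objective ::
    "'a measure \<Rightarrow> ('l \<Rightarrow> 'a \<Rightarrow> real) \<Rightarrow> ('m::real_vector \<Rightarrow> 'a \<Rightarrow> real) \<Rightarrow> ('m \<Rightarrow> ereal) \<Rightarrow>
     real \<Rightarrow> 'm \<Rightarrow> real \<times> real \<Rightarrow> ereal" where
  "dual_objective P embL embM V \<epsilon> X = (\<lambda>(\<mu>, lam).
     ereal (\<mu> + lam * \<epsilon>) +
     conjugate_L P embL embM (scale_conv lam (divergence P embL embM V)) (X - const_elem P embM \<mu>))"

definition variational_density ::
    "'a measure \<Rightarrow> ('l \<Rightarrow> 'a \<Rightarrow> real) \<Rightarrow> ('m \<Rightarrow> 'a \<Rightarrow> real) \<Rightarrow> ('m \<Rightarrow> ereal) \<Rightarrow>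
     real \<Rightarrow> 'm \<Rightarrow> 'l \<Rightarrow> bool" where
  "variational_density P embL embM V \<epsilon> X p \<longleftrightarrow>
     is_arg_max (\<lambda>q. pairing P embL embM q X) (\<lambda>q. q \<in> density_ball P embL embM V \<epsilon>) p"

end

theory Submission
  imports Defs
begin

text \<open>
  Weak lower semicontinuity gives \<open>V = \<Phi>\<^sup>*\<close> by a separation argument that involves only finitely
  many functionals, since a basic weak neighbourhood does. Hence the dual objective at \<open>(\<mu>, \<lambda>)\<close> is
  the supremum over \<open>p\<close> in the domain of \<open>\<Phi>\<close> of the Lagrangian
  \<open>\<langle>p, X\<rangle> + \<mu> (1 - E p) + \<lambda> (\<epsilon> - \<Phi> p)\<close> of the problem of maximizing \<open>\<langle>p, X\<rangle>\<close> subject to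
  \<open>E p = 1\<close> and \<open>\<Phi> p \<le> \<epsilon>\<close>, and all minima are attained by the existence of Lagrange multipliers.
  The constraint qualification holds because \<open>V t > t\<close> for nonzero constants \<open>t\<close> yields \<open>p\<close> in the
  domain with \<open>E p\<close> on either side of \<open>1\<close>, and the constant density \<open>1\<close> has \<open>\<Phi> 1 = 0\<close>. The
  subgradients of the positively homogeneous function \<open>\<R>\<^sup>\<epsilon>\<close> at \<open>X\<close> that lie in \<open>\<L>\<close> are the
  feasible \<open>p\<close> with \<open>\<langle>p, X\<rangle> = \<R>\<^sup>\<epsilon> X\<close>, and equality in the Fenchel-Young inequality describes
  them by the subdifferential of \<open>V\<close>.
\<close>

section \<open>Separation by finitely many functionals\<close>

lemma convex_on_affine:
  assumes "linear f" and "convex S"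
  shows "convex_on S (\<lambda>x. a * (f x - b) :: real)"
  unfolding convex_on_def
proof (intro conjI assms(2) ballI allI impI)
  fix x y and u v :: real
  assume "u + v = 1"
  then have u: "u = 1 - v" by simp
  show "a * (f (u *\<^sub>R x + v *\<^sub>R y) - b) \<le> u * (a * (f x - b)) + v * (a * (f y - b))"
    unfolding linear_add[OF assms(1)] linear_scale[OF assms(1)] u
    by (simp add: algebra_simps)
qed

lemma convex_on_abs_affine:
  assumes "linear f" and "convex S"
  shows "convex_on S (\<lambda>x. \<bar>f x - b :: real\<bar>)"
  unfolding convex_on_def
proof (intro conjI assms(2) ballI allI impI)
  fix x y and u v :: real
  assume uv: "0 \<le> u" "0 \<le> v" "u + v = 1"
  have "f (u *\<^sub>R x + v *\<^sub>R y) - (u + v) * b = u * (f x - b) + v * (f y - b)"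
    unfolding linear_add[OF assms(1)] linear_scale[OF assms(1)]
    by (simp add: algebra_simps)
  also have "\<bar>\<dots>\<bar> \<le> u * \<bar>f x - b\<bar> + v * \<bar>f y - b\<bar>"
    using uv abs_triangle_ineq[of "u * (f x - b)" "v * (f y - b)"] by (simp add: abs_mult)
  finally show "\<bar>f (u *\<^sub>R x + v *\<^sub>R y) - b\<bar> \<le> u * \<bar>f x - b\<bar> + v * \<bar>f y - b\<bar>"
    using uv by simp
qed

lemma convex_on_sum_functions:
  assumes "convex S" and "\<And>i. i \<in> I \<Longrightarrow> convex_on S (g i)"
  shows "convex_on S (\<lambda>x. \<Sum>i\<in>I. g i x :: real)"
  using assms(2)
  by (induction I rule: infinite_finite_induct)
    (auto intro: convex_on_add convex_on_const[THEN iffD2] assms(1))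

lemma convex_on_weighted_mean:
  assumes "convex_on S h" and "x \<in> S" "y \<in> S" and "s > 0" "t > 0"
  shows "h ((s / (s + t)) *\<^sub>R x + (t / (s + t)) *\<^sub>R y) \<le> (s * h x + t * h y) / (s + t)"
proof -
  have "s / (s + t) + t / (s + t) = 1"
    using assms by (simp add: add_divide_distrib[symmetric])
  then have "h ((s / (s + t)) *\<^sub>R x + (t / (s + t)) *\<^sub>R y)
      \<le> s / (s + t) * h x + t / (s + t) * h y"
    using assms unfolding convex_on_def by (meson add_pos_pos divide_pos_pos less_imp_le)
  then show ?thesis by (simp add: add_divide_distrib)
qed

text \<open>The segment from \<open>y\<close> to \<open>x\<close> crosses the hyperplane
  \<open>f = b\<close> at \<open>z\<close>, where each end point is weighted by the distance of the
  other one from the hyperplane. There \<open>G\<close> is nonnegative and at most the weighted mean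
  of its end values; rearranging orders the slopes.\<close>

lemma slopes_ordered:
  fixes G f :: "'c::real_vector \<Rightarrow> real"
  assumes G: "convex_on S G" and f: "linear f"
    and zero: "\<And>x. x \<in> S \<Longrightarrow> f x = b \<Longrightarrow> G x \<ge> 0"
    and x: "x \<in> S" "f x > b" and y: "y \<in> S" "f y < b"
  shows "G y / (f y - b) \<le> G x / (f x - b)"
proof -
  define s t where "s = b - f y" and "t = f x - b"
  have st: "s > 0" "t > 0" using x y by (auto simp: s_def t_def)
  define z where "z = (s / (s + t)) *\<^sub>R x + (t / (s + t)) *\<^sub>R y"
  have w: "s / (s + t) + t / (s + t) = 1" using st by (simp add: add_divide_distrib[symmetric])
  have "z \<in> S"
    using G x y st w unfolding z_def convex_on_def by (auto intro!: convexD)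
  moreover have "f z = b"
  proof -
    have "f z = (s * f x + t * f y) / (s + t)"
      unfolding z_def linear_add[OF f] linear_scale[OF f] by (simp add: add_divide_distrib)
    also have "s * f x + t * f y = b * (s + t)"
      by (simp add: s_def t_def algebra_simps)
    finally show ?thesis using st by simp
  qed
  ultimately have "0 \<le> G z" by (rule zero)
  also have "G z \<le> (s * G x + t * G y) / (s + t)"
    using convex_on_weighted_mean[OF G x(1) y(1) st] by (simp add: z_def)
  finally have "0 \<le> s * G x + t * G y" using st by (simp add: zero_le_divide_iff)
  then have "- (G y / s) \<le> G x / t"
    using st by (simp add: field_simps)
  moreover have "G y / (f y - b) = - (G y / s)"
    by (metis minus_diff_eq minus_divide_right s_def)
  ultimately show ?thesis
    by (simp add: t_def)
qed

text \<open>The one-dimensional extension step in the proof of the Hahn-Banach theorem.\<close>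

lemma separating_slope:
  fixes G f :: "'c::real_vector \<Rightarrow> real"
  assumes G: "convex_on S G" and f: "linear f"
    and zero: "\<And>x. x \<in> S \<Longrightarrow> f x = b \<Longrightarrow> G x \<ge> 0"
    and upper: "\<And>x. x \<in> S \<Longrightarrow> f x > b \<Longrightarrow> u * (f x - b) \<le> G x"
    and lower: "\<And>x. x \<in> S \<Longrightarrow> f x < b \<Longrightarrow> l * (f x - b) \<le> G x"
  shows "\<exists>a. \<forall>x\<in>S. a * (f x - b) \<le> G x"
proof (cases "\<exists>x\<in>S. f x < b")
  case False
  then have "u * (f x - b) \<le> G x" if "x \<in> S" for x
    using zero[OF that] upper[OF that] that by (cases "f x = b") force+
  then show ?thesis by blast
next
  case True
  \<comment> \<open>The left slopes lie below \<open>l\<close> and, by \<open>cross\<close>, below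
    every right slope, so their supremum serves both sides.\<close>
  define A where "A = {G x / (f x - b) | x. x \<in> S \<and> f x < b}"
  have ne: "A \<noteq> {}" using True by (auto simp: A_def)
  have le_l: "s \<le> l" if "s \<in> A" for s
    using that lower by (auto simp: A_def divide_le_eq)
  then have bdd: "bdd_above A" by (rule bdd_aboveI)
  have cross: "G y / (f y - b) \<le> G x / (f x - b)"
    if "x \<in> S" "f x > b" "y \<in> S" "f y < b" for x y
    using slopes_ordered[OF G f zero] that by blast
  have "Sup A * (f x - b) \<le> G x" if x: "x \<in> S" for x
  proof (rule linorder_cases[of "f x" b])
    assume "f x < b"
    with x have "G x / (f x - b) \<in> A" by (auto simp: A_def)
    then have "G x / (f x - b) \<le> Sup A" using bdd by (rule cSup_upper)
    then show ?thesis using \<open>f x < b\<close> by (simp add: divide_le_eq)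
  next
    assume "f x = b"
    then show ?thesis using zero[OF x] by simp
  next
    assume gt: "f x > b"
    have "Sup A \<le> G x / (f x - b)"
      using ne cross[OF x gt] by (intro cSup_least) (auto simp: A_def)
    then show ?thesis using gt by (simp add: le_divide_eq)
  qed
  then show ?thesis by blast
qed

text \<open>Induction absorbs one functional at a time: the penalties of the others stay inside a
  convex \<open>G\<close> while a slope for \<open>f i\<close> is chosen. Subtracting that affine
  term from \<open>W\<close> restores the hypothesis for the remaining functionals.\<close>

lemma separating_combination:
  fixes f :: "'i \<Rightarrow> 'c::real_vector \<Rightarrow> real"
  assumes "finite I" and "convex_on S W" and "\<And>i. i \<in> I \<Longrightarrow> linear (f i)" and "K \<ge> 0"
    and "\<And>x. x \<in> S \<Longrightarrow> 0 \<le> W x + K * (\<Sum>i\<in>I. \<bar>f i x - b i\<bar>)"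
  shows "\<exists>a. \<forall>x\<in>S. (\<Sum>i\<in>I. a i * (f i x - b i)) \<le> W x"
  using assms
proof (induction I arbitrary: W rule: finite_induct)
  case empty
  then show ?case by simp
next
  case (insert i I)
  note cS = convex_on_imp_convex[OF insert.prems(1)]
  define G where "G x = W x + K * (\<Sum>i\<in>I. \<bar>f i x - b i\<bar>)" for x
  have G: "convex_on S G"
    unfolding G_def
    using insert cS
    by (intro convex_on_add convex_on_cmul convex_on_sum_functions convex_on_abs_affine) auto
  have GK: "0 \<le> G x + K * \<bar>f i x - b i\<bar>" if "x \<in> S" for x
    using insert.prems(4)[OF that] insert.hyps by (simp add: G_def algebra_simps)
  \<comment> \<open>The remaining penalty \<open>K * \<bar>f i x - b i\<bar>\<close> supplies the
    two slope bounds: \<open>- K\<close> where \<open>f i\<close> exceeds \<open>b i\<close>, and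
    \<open>K\<close> where it is smaller.\<close>
  obtain a where a: "\<forall>x\<in>S. a * (f i x - b i) \<le> G x"
    using separating_slope[OF G, of "f i" "b i" "- K" K] insert.prems(2)[of i] GK
    by (force simp: algebra_simps)
  have "convex_on S (\<lambda>x. W x + (- a) * (f i x - b i))"
    using insert.prems by (intro convex_on_add convex_on_affine cS) auto
  moreover have "0 \<le> W x + (- a) * (f i x - b i) + K * (\<Sum>i\<in>I. \<bar>f i x - b i\<bar>)" if "x \<in> S" for x
    using a that by (auto simp: G_def)
  ultimately obtain a' where
    a': "\<forall>x\<in>S. (\<Sum>i\<in>I. a' i * (f i x - b i)) \<le> W x + (- a) * (f i x - b i)"
    using insert.IH[of "\<lambda>x. W x + (- a) * (f i x - b i)"] insert.prems by auto
  have "(\<Sum>j\<in>insert i I. (a'(i := a)) j * (f j x - b j)) \<le> W x" if "x \<in> S" for x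
  proof -
    have "(\<Sum>j\<in>I. (a'(i := a)) j * (f j x - b j)) = (\<Sum>j\<in>I. a' j * (f j x - b j))"
      using insert.hyps by (intro sum.cong) auto
    then show ?thesis using a' that insert.hyps by (fastforce simp: algebra_simps)
  qed
  then show ?case by blast
qed

text \<open>A point with \<open>g > 0\<close> and one with \<open>g < 0\<close> have a convex
  combination with \<open>g \<le> 0\<close>, where \<open>G\<close> is nonnegative. Convexity of
  \<open>G\<close> then puts each lower bound for the multiplier below each upper bound, and the
  Slater point provides an upper bound.\<close>

lemma slater_multiplier:
  fixes G g :: "'c::real_vector \<Rightarrow> real"
  assumes G: "convex_on S G" and g: "convex_on S g"
    and nonneg: "\<And>x. x \<in> S \<Longrightarrow> g x \<le> 0 \<Longrightarrow> G x \<ge> 0"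
    and slater: "x0 \<in> S" "g x0 < 0"
  shows "\<exists>lam\<ge>0. \<forall>x\<in>S. G x + lam * g x \<ge> 0"
proof -
  \<comment> \<open>The inserted \<open>0\<close> makes the supremum nonnegative and keeps the set
    nonempty.\<close>
  define A where "A = insert 0 {- G x / g x | x. x \<in> S \<and> g x > 0}"
  have cross: "- G x / g x \<le> G y / - g y"
    if x: "x \<in> S" "g x > 0" and y: "y \<in> S" "g y < 0" for x y
  proof -
    define s t where "s = - g y" and "t = g x"
    have st: "s > 0" "t > 0" using x y by (auto simp: s_def t_def)
    define z where "z = (s / (s + t)) *\<^sub>R x + (t / (s + t)) *\<^sub>R y"
    have w: "s / (s + t) + t / (s + t) = 1" using st by (simp add: add_divide_distrib[symmetric])
    have zS: "z \<in> S"
      using G x y st w unfolding z_def convex_on_def by (auto intro!: convexD)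
    have "g z \<le> (s * g x + t * g y) / (s + t)"
      using convex_on_weighted_mean[OF g x(1) y(1) st] by (simp add: z_def)
    also have "\<dots> = 0"
      by (simp add: s_def t_def)
    finally have "0 \<le> G z" using nonneg zS by blast
    also have "G z \<le> (s * G x + t * G y) / (s + t)"
      using convex_on_weighted_mean[OF G x(1) y(1) st] by (simp add: z_def)
    finally have "0 \<le> s * G x + t * G y" using st by (simp add: zero_le_divide_iff)
    then have "- G x / t \<le> G y / s"
      using st by (simp add: field_simps)
    then show ?thesis by (simp add: s_def t_def)
  qed
  have ub: "s \<le> G y / - g y" if "s \<in> A" "y \<in> S" "g y < 0" for s y
  proof -
    have "0 \<le> G y / - g y" using nonneg[of y] that by (intro divide_nonneg_pos) auto
    then show ?thesis using that cross unfolding A_def by blast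
  qed
  have bdd: "bdd_above A" using ub[OF _ slater] by (rule bdd_aboveI)
  have "Sup A \<ge> 0" using bdd by (intro cSup_upper) (auto simp: A_def)
  moreover have "G x + Sup A * g x \<ge> 0" if x: "x \<in> S" for x
  proof (rule linorder_cases[of "g x" 0])
    assume neg: "g x < 0"
    have "Sup A \<le> G x / - g x" using ub[OF _ x neg] by (intro cSup_least) (auto simp: A_def)
    then show ?thesis using neg by (simp add: field_simps)
  next
    assume "g x = 0"
    then show ?thesis using nonneg[OF x] by simp
  next
    assume pos: "g x > 0"
    have "- G x / g x \<le> Sup A" using bdd x pos by (intro cSup_upper) (auto simp: A_def)
    then show ?thesis using pos by (simp add: field_simps)
  qed
  ultimately show ?thesis by blast
qed

section \<open>From convex epigraphs to real convex functions on the domain\<close>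

lemma convex_on_real_of_ereal:
  assumes f: "convex_ereal f" and ninf: "\<And>x. f x \<noteq> -\<infinity>"
  shows "convex_on {x. f x \<noteq> \<infinity>} (\<lambda>x. real_of_ereal (f x))"
proof -
  have key: "f (u *\<^sub>R x + v *\<^sub>R y) \<le> ereal (u * real_of_ereal (f x) + v * real_of_ereal (f y))"
    if "f x \<noteq> \<infinity>" "f y \<noteq> \<infinity>" "u \<ge> 0" "v \<ge> 0" "u + v = 1" for x y u v
  proof -
    have "(x, real_of_ereal (f x)) \<in> {(x, r). f x \<le> ereal r}"
      and "(y, real_of_ereal (f y)) \<in> {(x, r). f x \<le> ereal r}"
      using that ninf by (auto simp: ereal_real)
    then show ?thesis
      using convexD[OF f[unfolded convex_ereal_def] _ _ that(3-5)] by fastforce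
  qed
  show ?thesis
    unfolding convex_on_def convex_def
  proof (intro conjI ballI allI impI)
    fix x y and u v :: real
    assume *: "x \<in> {x. f x \<noteq> \<infinity>}" "y \<in> {x. f x \<noteq> \<infinity>}" "0 \<le> u" "0 \<le> v" "u + v = 1"
    then show "u *\<^sub>R x + v *\<^sub>R y \<in> {x. f x \<noteq> \<infinity>}"
      using key[of x y u v] by auto
    show "real_of_ereal (f (u *\<^sub>R x + v *\<^sub>R y)) \<le> u * real_of_ereal (f x) + v * real_of_ereal (f y)"
      using key[of x y u v] * ninf[of "u *\<^sub>R x + v *\<^sub>R y"]
      by (cases "f (u *\<^sub>R x + v *\<^sub>R y)") auto
  qed
qed

section \<open>The pairing\<close>

context paired_spaces
begin

abbreviation pair ("\<langle>_, _\<rangle>") where "\<langle>p, X\<rangle> \<equiv> pairing P embL embM p X"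
abbreviation oneL where "oneL \<equiv> const_elem P embL 1"
abbreviation oneM where "oneM \<equiv> const_elem P embM 1"

lemma linear_pair_M: "linear (\<lambda>X. \<langle>p, X\<rangle>)"
  using pairing_dual_M bounded_linear.linear by blast

lemma linear_pair_L: "linear (\<lambda>p. \<langle>p, X\<rangle>)"
  using pairing_dual_L bounded_linear.linear by blast

lemmas pair_simps =
  linear_add[OF linear_pair_M] linear_diff[OF linear_pair_M] linear_scale[OF linear_pair_M]
  linear_0[OF linear_pair_M] linear_neg[OF linear_pair_M]
  linear_add[OF linear_pair_L] linear_diff[OF linear_pair_L] linear_scale[OF linear_pair_L]
  linear_0[OF linear_pair_L] linear_sum[OF linear_pair_L]

lemma to_dual_apply: "blinfun_apply (to_dual P embL embM p) X = \<langle>p, X\<rangle>"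
  unfolding to_dual_def using pairing_dual_M by (simp add: bounded_linear_Blinfun_apply)

text \<open>Translation by constants thus moves along a single vector, so its effect on a pairing
  depends only on \<open>\<langle>p, oneM\<rangle>\<close>.\<close>

lemma const_elem_M: "const_elem P embM t = t *\<^sub>R oneM"
proof (rule M.emb_inj)
  show "AE \<theta> in P. embM (const_elem P embM t) \<theta> = embM (t *\<^sub>R oneM) \<theta>"
    using M.const_elem[of t] M.const_elem[of 1] M.emb_scaleR[of t oneM]
    by eventually_elim simp
qed

lemma pair_oneL: "\<langle>oneL, X\<rangle> = expect P embM X"
  unfolding pairing_def expect_def
proof (rule integral_cong_AE)
  show "AE \<theta> in P. embL oneL \<theta> * embM X \<theta> = embM X \<theta>"
    using L.const_elem[of 1] by eventually_elim simp
qed (auto intro!: borel_measurable_times L.emb_measurable M.emb_measurable)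

lemma pair_oneM: "\<langle>p, oneM\<rangle> = expect P embL p"
  unfolding pairing_def expect_def
proof (rule integral_cong_AE)
  show "AE \<theta> in P. embL p \<theta> * embM oneM \<theta> = embL p \<theta>"
    using M.const_elem[of 1] by eventually_elim simp
qed (auto intro!: borel_measurable_times L.emb_measurable M.emb_measurable)

lemma integrable_L: "integrable P (embL p)"
proof (subst integrable_cong_AE)
  show "AE \<theta> in P. embL p \<theta> = embL p \<theta> * embM oneM \<theta>"
    using M.const_elem[of 1] by eventually_elim simp
qed (auto intro!: borel_measurable_times L.emb_measurable M.emb_measurable pairing_integrable)

lemma pair_one_one: "\<langle>oneL, oneM\<rangle> = 1"
proof -
  have "\<langle>oneL, oneM\<rangle> = (\<integral>\<theta>. 1 \<partial>P)"
    unfolding pair_oneL expect_def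
    by (rule integral_cong_AE) (auto intro!: M.emb_measurable M.const_elem)
  then show ?thesis by (simp add: prob_space)
qed

text \<open>Induction over the generation of the topology: an intersection unites the finite sets of
  functionals and takes the smaller radius.\<close>

lemma weak_neighbourhood:
  assumes "openin (weak_top P embL embM) U" and "X \<in> U"
  shows "\<exists>F \<delta>. finite F \<and> \<delta> > 0 \<and> (\<forall>Y. (\<forall>p\<in>F. \<bar>\<langle>p, Y - X\<rangle>\<bar> < \<delta>) \<longrightarrow> Y \<in> U)"
  using assms unfolding weak_top_def openin_topology_generated_by_iff
proof (induction arbitrary: X rule: generate_topology_on.induct)
  case Empty
  then show ?case by simp
next
  case (Int a b)
  obtain F \<delta> where 1: "finite F" "\<delta> > 0" "\<And>Y. (\<forall>p\<in>F. \<bar>\<langle>p, Y - X\<rangle>\<bar> < \<delta>) \<Longrightarrow> Y \<in> a"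
    using Int.IH(1)[of X] Int.prems by auto
  obtain F' \<delta>' where 2: "finite F'" "\<delta>' > 0" "\<And>Y. (\<forall>p\<in>F'. \<bar>\<langle>p, Y - X\<rangle>\<bar> < \<delta>') \<Longrightarrow> Y \<in> b"
    using Int.IH(2)[of X] Int.prems by auto
  show ?case
    using 1 2 by (intro exI[of _ "F \<union> F'"] exI[of _ "min \<delta> \<delta>'"]) auto
next
  case (UN K)
  then obtain k where "k \<in> K" "X \<in> k" by blast
  with UN.IH[of k X] show ?case by blast
next
  case (Basis s)
  then obtain p U where s: "s = {X. \<langle>p, X\<rangle> \<in> U}" "open U" by blast
  then obtain \<delta> where "\<delta> > 0" "\<And>r. dist r \<langle>p, X\<rangle> < \<delta> \<Longrightarrow> r \<in> U"
    using Basis.prems open_dist[of U] by blast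
  then show ?case
    using s by (intro exI[of _ "{p}"] exI[of _ \<delta>]) (auto simp: pair_simps dist_real_def)
qed

lemma topspace_weak_top: "topspace (weak_top P embL embM) = UNIV"
  unfolding weak_top_def topology_generated_by_topspace by blast

end

section \<open>Biconjugation\<close>

context risk_averse_disutility
begin

abbreviation Phi where "Phi \<equiv> divergence P embL embM V"
abbreviation domPhi where "domPhi \<equiv> {p. Phi p \<noteq> \<infinity>}"
text \<open>A real version to which the separation lemmas apply. Outside \<open>domPhi\<close> it
  takes the default value 0, so the duality statements quantify over \<open>domPhi\<close>.\<close>

definition phi where "phi p = real_of_ereal (Phi p)"

section \<open>Elementary properties of the divergence\<close>

lemma V_not_minf: "V X \<noteq> -\<infinity>"
  using V_proper by (simp add: proper_def)

lemma V_ge_pair: "V X \<ge> ereal \<langle>oneL, X\<rangle>"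
  using V_ge by (simp add: pair_oneL)

text \<open>Real upper bounds describe the supremum without subtraction of infinite values;
  \<open>V_le_iff\<close> and \<open>conjugate_le_iff\<close> follow the same pattern.\<close>

lemma divergence_le_iff: "Phi p \<le> ereal r \<longleftrightarrow> (\<forall>X. ereal \<langle>p, X\<rangle> \<le> ereal r + V X)"
proof -
  have "ereal \<langle>p, X\<rangle> - V X \<le> ereal r \<longleftrightarrow> ereal \<langle>p, X\<rangle> \<le> ereal r + V X" for X
    using V_not_minf[of X] by (cases "V X") auto
  then show ?thesis by (simp add: divergence_def SUP_le_iff)
qed

lemma divergence_nonneg: "Phi p \<ge> 0"
proof -
  have "ereal \<langle>p, 0\<rangle> - V 0 \<le> Phi p"
    unfolding divergence_def by (rule SUP_upper) simp
  then show ?thesis by (simp add: V_zero pair_simps zero_ereal_def[symmetric])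
qed

lemma divergence_real: "p \<in> domPhi \<Longrightarrow> Phi p = ereal (phi p)"
  using divergence_nonneg[of p] by (cases "Phi p") (auto simp: phi_def)

lemma phi_nonneg: "phi p \<ge> 0"
  unfolding phi_def using divergence_nonneg by (rule real_of_ereal_pos)

lemma fenchel_young: "p \<in> domPhi \<Longrightarrow> ereal \<langle>p, X\<rangle> \<le> ereal (phi p) + V X"
  using divergence_le_iff[of p "phi p"] divergence_real[of p] by simp

text \<open>The axiom that \<open>V\<close> dominates the expectation says exactly that this
  divergence is at most 0.\<close>

lemma divergence_oneL: "Phi oneL = 0"
  using divergence_le_iff[of oneL 0] V_ge_pair divergence_nonneg[of oneL]
  by (intro antisym) (auto simp: zero_ereal_def[symmetric])

lemma oneL_in_dom: "oneL \<in> domPhi"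
  by (simp add: divergence_oneL)

lemma convex_divergence: "convex_ereal Phi"
  unfolding convex_ereal_def convex_def
proof (clarsimp)
  fix p r q s and u v :: real
  assume *: "Phi p \<le> ereal r" "Phi q \<le> ereal s" "0 \<le> u" "0 \<le> v" "u + v = 1"
  have "ereal \<langle>u *\<^sub>R p + v *\<^sub>R q, X\<rangle> \<le> ereal (u * r + v * s) + V X" for X
  proof (cases "V X")
    case (real w)
    have "\<langle>p, X\<rangle> \<le> r + w" "\<langle>q, X\<rangle> \<le> s + w"
      using *(1,2) real by (auto simp: divergence_le_iff dest!: spec[of _ X])
    then have "u * \<langle>p, X\<rangle> + v * \<langle>q, X\<rangle> \<le> u * (r + w) + v * (s + w)"
      using * by (intro add_mono mult_left_mono) auto
    also have "\<dots> = u * r + v * s + (u + v) * w" by (simp add: algebra_simps)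
    finally show ?thesis using real * by (simp add: pair_simps)
  qed (use V_not_minf[of X] in auto)
  then show "Phi (u *\<^sub>R p + v *\<^sub>R q) \<le> ereal (u * r + v * s)"
    by (simp add: divergence_le_iff)
qed

lemma convex_on_phi: "convex_on domPhi phi"
  unfolding phi_def[abs_def]
  using divergence_nonneg by (intro convex_on_real_of_ereal convex_divergence) force

text \<open>
  Near \<open>X\<close> the function \<open>V\<close> exceeds \<open>c\<close>, and elsewhere it exceeds the expectation. Hence, up to
  the affine function given by \<open>oneL\<close>, it is bounded below by a multiple of a seminorm built from
  finitely many elements of the dual; \<open>separating_combination\<close> turns the latter into an affine
  minorant. The minorant given by \<open>oneL\<close> rules out vertical hyperplanes.
\<close>

lemma affine_minorant:
  assumes c: "ereal c < V X"
  shows "\<exists>p. Phi p \<le> ereal (\<langle>p, X\<rangle> - c)"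
proof -
  obtain c1 where c1: "c < c1" "ereal c1 < V X"
    using ereal_dense2[OF c] by auto
  have "openin (weak_top P embL embM) {Y. ereal c1 < V Y}"
    using V_lsc by (simp add: lsc_in_def topspace_weak_top)
  then obtain F \<delta> where F: "finite F" "\<delta> > 0"
      "\<And>Y. (\<forall>p\<in>F. \<bar>\<langle>p, Y - X\<rangle>\<bar> < \<delta>) \<Longrightarrow> ereal c1 < V Y"
    using weak_neighbourhood[of "{Y. ereal c1 < V Y}" X] c1 by auto
  \<comment> \<open>With this radius the \<open>oneL\<close> term changes near \<open>X\<close> by
    less than the gap \<open>c1 - c\<close>, so \<open>G\<close> is nonnegative there.\<close>
  define d where "d = min \<delta> (c1 - c)"
  have d: "d > 0" using F c1 by (simp add: d_def)
  \<comment> \<open>Away from \<open>X\<close> some penalty is at least \<open>K * d\<close>, which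
    offsets the constant part of \<open>G\<close>; the rest,
    \<open>W Y - \<langle>oneL, Y\<rangle>\<close>, is nonnegative.\<close>
  define K where "K = \<bar>\<langle>oneL, X\<rangle> - c\<bar> / d"
  define S where "S = {Y. V Y \<noteq> \<infinity>}"
  define W where "W Y = real_of_ereal (V Y)" for Y
  have VW: "V Y = ereal (W Y)" if "Y \<in> S" for Y
    using that V_not_minf[of Y] unfolding S_def W_def by (cases "V Y") auto
  have W: "convex_on S W"
    unfolding S_def W_def by (intro convex_on_real_of_ereal V_convex V_not_minf)
  define G where "G Y = W Y + (- 1) * (\<langle>oneL, Y\<rangle> - (\<langle>oneL, X\<rangle> - c))" for Y
  have G: "convex_on S G"
    unfolding G_def
    by (intro convex_on_add W convex_on_affine linear_pair_M convex_on_imp_convex[OF W])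
  have "0 \<le> G Y + K * (\<Sum>p\<in>insert oneL F. \<bar>\<langle>p, Y\<rangle> - \<langle>p, X\<rangle>\<bar>)" if Y: "Y \<in> S" for Y
  proof (cases "\<forall>p\<in>insert oneL F. \<bar>\<langle>p, Y\<rangle> - \<langle>p, X\<rangle>\<bar> < d")
    case True
    then have "ereal c1 < V Y" by (intro F) (auto simp: d_def pair_simps)
    moreover have "\<bar>\<langle>oneL, Y\<rangle> - \<langle>oneL, X\<rangle>\<bar> < c1 - c" using True by (auto simp: d_def)
    ultimately have "0 \<le> G Y" using VW[OF Y] by (auto simp: G_def)
    moreover have "0 \<le> K" using d by (simp add: K_def)
    ultimately show ?thesis by (simp add: sum_nonneg)
  next
    case False
    then obtain p where p: "p \<in> insert oneL F" "d \<le> \<bar>\<langle>p, Y\<rangle> - \<langle>p, X\<rangle>\<bar>" by force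
    have "\<bar>\<langle>p, Y\<rangle> - \<langle>p, X\<rangle>\<bar> \<le> (\<Sum>p\<in>insert oneL F. \<bar>\<langle>p, Y\<rangle> - \<langle>p, X\<rangle>\<bar>)"
      using p F by (intro member_le_sum) auto
    then have "K * d \<le> K * (\<Sum>p\<in>insert oneL F. \<bar>\<langle>p, Y\<rangle> - \<langle>p, X\<rangle>\<bar>)"
      using p d by (intro mult_left_mono) (auto simp: K_def)
    moreover have "K * d = \<bar>\<langle>oneL, X\<rangle> - c\<bar>" using d by (simp add: K_def)
    moreover have "\<langle>oneL, Y\<rangle> \<le> W Y" using V_ge_pair[of Y] VW[OF Y] by simp
    ultimately show ?thesis by (auto simp: G_def)
  qed
  then obtain a where
    a: "\<forall>Y\<in>S. (\<Sum>p\<in>insert oneL F. a p * (\<langle>p, Y\<rangle> - \<langle>p, X\<rangle>)) \<le> G Y"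
    using separating_combination[of "insert oneL F" S G "\<lambda>p X. \<langle>p, X\<rangle>" K "\<lambda>p. \<langle>p, X\<rangle>"]
      F G linear_pair_M d by (auto simp: K_def)
  \<comment> \<open>Adding \<open>oneL\<close> undoes its subtraction in \<open>G\<close>.\<close>
  define p where "p = oneL + (\<Sum>p\<in>insert oneL F. a p *\<^sub>R p)"
  have p: "\<langle>p, Y - X\<rangle> = \<langle>oneL, Y\<rangle> - \<langle>oneL, X\<rangle> + (\<Sum>p\<in>insert oneL F. a p * (\<langle>p, Y\<rangle> - \<langle>p, X\<rangle>))" for Y
    unfolding p_def
    by (simp only: pair_simps) (simp add: sum_subtractf right_diff_distrib)
  have "ereal \<langle>p, Y\<rangle> \<le> ereal (\<langle>p, X\<rangle> - c) + V Y" for Y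
  proof (cases "Y \<in> S")
    case True
    then have "\<langle>p, Y - X\<rangle> \<le> W Y - c"
      using a p[of Y] by (force simp: G_def)
    then show ?thesis using VW[OF True] by (simp add: pair_simps)
  next
    case False
    then show ?thesis by (simp add: S_def)
  qed
  then show ?thesis using divergence_le_iff by blast
qed

text \<open>This is \<open>V = \<Phi>\<^sup>*\<close> in terms of upper bounds. If
  \<open>V X\<close> exceeded \<open>r\<close>, a \<open>c\<close> strictly in between would have an
  affine minorant \<open>p\<close> with
  \<open>\<langle>p, X\<rangle> - phi p \<ge> c > r\<close>.\<close>

lemma V_le_iff: "V X \<le> ereal r \<longleftrightarrow> (\<forall>p\<in>domPhi. \<langle>p, X\<rangle> - phi p \<le> r)"
proof
  assume *: "V X \<le> ereal r"
  show "\<forall>p\<in>domPhi. \<langle>p, X\<rangle> - phi p \<le> r"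
  proof
    fix p assume "p \<in> domPhi"
    then show "\<langle>p, X\<rangle> - phi p \<le> r"
      using fenchel_young[of p X] * by (cases "V X") auto
  qed
next
  assume *: "\<forall>p\<in>domPhi. \<langle>p, X\<rangle> - phi p \<le> r"
  show "V X \<le> ereal r"
  proof (rule ccontr)
    assume "\<not> V X \<le> ereal r"
    then obtain c where c: "r < c" "ereal c < V X"
      using ereal_dense2[of "ereal r" "V X"] by (auto simp: not_le)
    then obtain p where p: "Phi p \<le> ereal (\<langle>p, X\<rangle> - c)"
      using affine_minorant by blast
    then have "p \<in> domPhi" by auto
    with p have "phi p \<le> \<langle>p, X\<rangle> - c" using divergence_real by (metis ereal_less_eq(3))
    with * \<open>p \<in> domPhi\<close> c show False by fastforce
  qed
qed

section \<open>Densities\<close>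

text \<open>Testing with large negative multiples of the indicator of \<open>A\<close>, where
  \<open>p\<close> is negative: monotonicity makes \<open>V\<close> at most 0 there, so the integral
  of \<open>- p\<close> over \<open>A\<close>, times any positive scale, stays below
  \<open>phi p\<close> and must vanish.\<close>

lemma finite_divergence_nonneg:
  assumes p: "p \<in> domPhi"
  shows "AE \<theta> in P. embL p \<theta> \<ge> 0"
proof -
  define A where "A = {\<theta> \<in> space P. embL p \<theta> < 0}"
  have [measurable]: "embL p \<in> borel_measurable P" by (rule L.emb_measurable)
  have A: "A \<in> sets P" unfolding A_def by measurable
  obtain X where X: "AE \<theta> in P. embM X \<theta> = indicator A \<theta>"
    using M.emb_simple[of "indicator A"] A by auto
  have pX: "\<langle>p, X\<rangle> = (\<integral>\<theta>. embL p \<theta> * indicator A \<theta> \<partial>P)"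
    unfolding pairing_def
  proof (rule integral_cong_AE)
    show "AE \<theta> in P. embL p \<theta> * embM X \<theta> = embL p \<theta> * indicator A \<theta>"
      using X by eventually_elim simp
  qed (use A in \<open>auto intro!: borel_measurable_times M.emb_measurable\<close>)
  have int: "integrable P (\<lambda>\<theta>. - (embL p \<theta> * indicator A \<theta>))"
    using integrable_real_mult_indicator[OF A integrable_L[of p]] by simp
  have nonneg: "AE \<theta> in P. 0 \<le> - (embL p \<theta> * indicator A \<theta>)"
    by (auto simp: A_def indicator_def)
  have bound: "s * - \<langle>p, X\<rangle> \<le> phi p" if "s > 0" for s
  proof -
    have "AE \<theta> in P. embM ((- s) *\<^sub>R X) \<theta> \<le> embM 0 \<theta>"
      using X M.emb_scaleR[of "- s" X] M.emb_scaleR[of 0 X]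
      by eventually_elim (use that in \<open>auto simp: indicator_def\<close>)
    then have "V ((- s) *\<^sub>R X) \<le> 0" using V_mono V_zero by metis
    moreover have "ereal \<langle>p, (- s) *\<^sub>R X\<rangle> \<le> ereal (phi p) + V ((- s) *\<^sub>R X)"
      using fenchel_young[OF p] .
    ultimately show ?thesis
      by (cases "V ((- s) *\<^sub>R X)") (auto simp: pair_simps)
  qed
  have "- \<langle>p, X\<rangle> \<le> 0"
  proof (rule ccontr)
    assume "\<not> - \<langle>p, X\<rangle> \<le> 0"
    \<comment> \<open>This scale would yield \<open>phi p + 1 \<le> phi p\<close>.\<close>
    then show False
      using bound[of "(phi p + 1) / - \<langle>p, X\<rangle>"] phi_nonneg[of p]
      by (auto simp: field_simps split: if_splits)
  qed
  moreover have "- \<langle>p, X\<rangle> = (\<integral>\<theta>. - (embL p \<theta> * indicator A \<theta>) \<partial>P)"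
    using pX by simp
  moreover have "(\<integral>\<theta>. - (embL p \<theta> * indicator A \<theta>) \<partial>P) \<ge> 0"
    using nonneg by (rule integral_nonneg_AE)
  ultimately have "(\<integral>\<theta>. - (embL p \<theta> * indicator A \<theta>) \<partial>P) = 0" by linarith
  then have "AE \<theta> in P. - (embL p \<theta> * indicator A \<theta>) = 0"
    using integral_nonneg_eq_0_iff_AE[OF int nonneg] by blast
  then show ?thesis
    using AE_space by eventually_elim (auto simp: A_def indicator_def split: if_splits)
qed

text \<open>Finite divergence already forces the sign condition, which leaves one linear equation
  and one convex inequality as constraints.\<close>

lemma density_ball_iff:
  "p \<in> density_ball P embL embM V \<epsilon> \<longleftrightarrow> \<langle>p, oneM\<rangle> = 1 \<and> Phi p \<le> ereal \<epsilon>"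
proof (intro iffI conjI)
  assume "p \<in> density_ball P embL embM V \<epsilon>"
  then obtain d where d: "d \<in> borel_measurable P" "(\<integral>\<^sup>+\<theta>. d \<theta> \<partial>P) = 1"
      "AE \<theta> in P. enn2ereal (d \<theta>) = ereal (embL p \<theta>)" and "Phi p \<le> ereal \<epsilon>"
    by (auto simp: density_ball_def densities_def)
  then show "Phi p \<le> ereal \<epsilon>" by simp
  have nonneg: "AE \<theta> in P. 0 \<le> embL p \<theta>"
    using d(3) by eventually_elim (metis enn2ereal_nonneg ereal_less_eq(5))
  have "AE \<theta> in P. ennreal (embL p \<theta>) = d \<theta>"
    using d(3)
  proof eventually_elim
    fix \<theta> assume "enn2ereal (d \<theta>) = ereal (embL p \<theta>)"
    then show "ennreal (embL p \<theta>) = d \<theta>"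
      by (metis e2ennreal_enn2ereal e2ennreal_ereal)
  qed
  then have "(\<integral>\<^sup>+\<theta>. ennreal (embL p \<theta>) \<partial>P) = 1"
    using d(2) nn_integral_cong_AE by metis
  then show "\<langle>p, oneM\<rangle> = 1"
    unfolding pair_oneM expect_def
    using integral_eq_nn_integral[OF L.emb_measurable nonneg] by simp
next
  assume *: "\<langle>p, oneM\<rangle> = 1 \<and> Phi p \<le> ereal \<epsilon>"
  then have "p \<in> domPhi" by auto
  then have nonneg: "AE \<theta> in P. 0 \<le> embL p \<theta>" by (rule finite_divergence_nonneg)
  have "(\<integral>\<^sup>+\<theta>. ennreal (embL p \<theta>) \<partial>P) = 1"
    using nn_integral_eq_integral[OF integrable_L nonneg] * by (simp add: pair_oneM expect_def)
  then have "(\<lambda>\<theta>. ennreal (embL p \<theta>)) \<in> densities P"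
    using L.emb_measurable by (auto simp: densities_def)
  moreover have "AE \<theta> in P. enn2ereal (ennreal (embL p \<theta>)) = ereal (embL p \<theta>)"
    using nonneg by eventually_elim (simp add: enn2ereal_ennreal)
  ultimately show "p \<in> density_ball P embL embM V \<epsilon>"
    using * unfolding density_ball_def by (intro CollectI conjI bexI) auto
qed

section \<open>Duality\<close>

text \<open>The convention in \<open>scale_conv\<close> removes all \<open>p\<close> of infinite
  divergence, also for \<open>lam = 0\<close>.\<close>

lemma conjugate_le_iff:
  "conjugate_L P embL embM (scale_conv lam Phi) X \<le> ereal r \<longleftrightarrow>
     (\<forall>p\<in>domPhi. \<langle>p, X\<rangle> - lam * phi p \<le> r)"
proof -
  have "ereal \<langle>p, X\<rangle> - scale_conv lam Phi p \<le> ereal r \<longleftrightarrow>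
      (p \<in> domPhi \<longrightarrow> \<langle>p, X\<rangle> - lam * phi p \<le> r)" for p
  proof (cases "p \<in> domPhi")
    case True
    then have "scale_conv lam Phi p = ereal (lam * phi p)"
      using divergence_real[OF True] by (auto simp: scale_conv_def)
    then show ?thesis using True by simp
  qed (simp add: scale_conv_def)
  then show ?thesis by (simp add: conjugate_L_def SUP_le_iff)
qed

section \<open>The dual objective as a supremum of Lagrangians, and weak duality\<close>

abbreviation J where "J \<equiv> dual_objective P embL embM V"

lemma dual_objective_le_iff:
  "J \<epsilon> X (\<mu>, lam) \<le> ereal r \<longleftrightarrow>
     (\<forall>p\<in>domPhi. \<langle>p, X\<rangle> + \<mu> * (1 - \<langle>p, oneM\<rangle>) + lam * (\<epsilon> - phi p) \<le> r)"
proof -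
  have "ereal a + c \<le> ereal r \<longleftrightarrow> c \<le> ereal (r - a)" for a c
    by (cases c) auto
  then have "J \<epsilon> X (\<mu>, lam) \<le> ereal r \<longleftrightarrow>
      (\<forall>p\<in>domPhi. \<langle>p, X - \<mu> *\<^sub>R oneM\<rangle> - lam * phi p \<le> r - (\<mu> + lam * \<epsilon>))"
    by (simp add: dual_objective_def conjugate_le_iff const_elem_M[of \<mu>])
  also have "\<dots> \<longleftrightarrow> (\<forall>p\<in>domPhi. \<langle>p, X\<rangle> + \<mu> * (1 - \<langle>p, oneM\<rangle>) + lam * (\<epsilon> - phi p) \<le> r)"
    by (intro ball_cong refl) (auto simp: pair_simps algebra_simps)
  finally show ?thesis .
qed

text \<open>Dividing by \<open>lam\<close> turns upper bounds for the conjugate of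
  \<open>lam * Phi\<close> into those of \<open>V_le_iff\<close> at the rescaled point.\<close>

lemma conjugate_pos:
  assumes "lam > 0"
  shows "conjugate_L P embL embM (scale_conv lam Phi) X = ereal lam * V (inverse lam *\<^sub>R X)"
proof -
  have "ereal lam * v \<le> ereal r \<longleftrightarrow> v \<le> ereal (r / lam)" for v r
    using assms by (cases v) (auto simp: field_simps)
  moreover have "\<langle>p, inverse lam *\<^sub>R X\<rangle> - phi p \<le> r / lam \<longleftrightarrow> \<langle>p, X\<rangle> - lam * phi p \<le> r" for p r
  proof -
    have "\<langle>p, inverse lam *\<^sub>R X\<rangle> - phi p = (\<langle>p, X\<rangle> - lam * phi p) / lam"
      using assms by (simp add: pair_simps divide_inverse algebra_simps)
    then show ?thesis using assms by (simp add: divide_le_cancel)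
  qed
  ultimately have "conjugate_L P embL embM (scale_conv lam Phi) X \<le> ereal r \<longleftrightarrow>
      ereal lam * V (inverse lam *\<^sub>R X) \<le> ereal r" for r
    by (simp add: conjugate_le_iff V_le_iff)
  then show ?thesis
    by (metis antisym ereal_le_real)
qed

lemma dual_objective_pos:
  assumes "lam > 0"
  shows "J \<epsilon> X (\<mu>, lam) = ereal (lam * \<epsilon>) + regret P embM V lam X \<mu>"
proof -
  have "ereal (\<mu> + lam * \<epsilon>) = ereal (lam * \<epsilon>) + ereal \<mu>" by simp
  then show ?thesis
    using assms by (simp only: dual_objective_def regret_def conjugate_pos add.assoc prod.case)
qed

text \<open>At a feasible \<open>p\<close> the mass term of the Lagrangian vanishes and the
  divergence term is nonnegative.\<close>

lemma weak_duality:
  assumes p: "p \<in> density_ball P embL embM V \<epsilon>" and lam: "lam \<ge> 0"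
  shows "ereal \<langle>p, X\<rangle> \<le> J \<epsilon> X (\<mu>, lam)"
proof (rule ereal_le_real)
  fix r assume "J \<epsilon> X (\<mu>, lam) \<le> ereal r"
  moreover have dom: "p \<in> domPhi" and one: "\<langle>p, oneM\<rangle> = 1"
    using p by (auto simp: density_ball_iff)
  ultimately have "\<langle>p, X\<rangle> + lam * (\<epsilon> - phi p) \<le> r"
    by (auto simp: dual_objective_le_iff)
  moreover have "phi p \<le> \<epsilon>"
    using p divergence_real[OF dom] by (simp add: density_ball_iff)
  ultimately show "ereal \<langle>p, X\<rangle> \<le> ereal r"
    using mult_nonneg_nonneg[OF lam, of "\<epsilon> - phi p"]
    by (simp only: ereal_less_eq) linarith
qed

text \<open>A nonzero constant has \<open>V\<close> strictly above its expectation \<open>t\<close>,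
  so an affine minorant passes above \<open>t\<close> there. The values 1 and -1 of \<open>t\<close>
  give total mass above and below 1.\<close>

lemma ex_total_mass_beyond:
  assumes "t \<noteq> 0"
  shows "\<exists>p\<in>domPhi. t < t * \<langle>p, oneM\<rangle>"
proof -
  have t: "\<langle>oneL, t *\<^sub>R oneM\<rangle> = t"
    by (simp add: pair_simps pair_one_one)
  then have "t *\<^sub>R oneM \<noteq> 0"
    using assms by (auto simp: pair_simps)
  then have "V (t *\<^sub>R oneM) \<noteq> ereal t"
    using V_eq[of "t *\<^sub>R oneM"] t by (auto simp: pair_oneL)
  then have "ereal t < V (t *\<^sub>R oneM)"
    using V_ge_pair[of "t *\<^sub>R oneM"] t by simp
  then obtain c where c: "t < c" "ereal c < V (t *\<^sub>R oneM)"
    using ereal_dense2 by force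
  then obtain p where p: "Phi p \<le> ereal (\<langle>p, t *\<^sub>R oneM\<rangle> - c)"
    using affine_minorant by blast
  then have "0 \<le> ereal (\<langle>p, t *\<^sub>R oneM\<rangle> - c)"
    using divergence_nonneg[of p] by (rule order_trans[rotated])
  then have "t < t * \<langle>p, oneM\<rangle>" using c by (simp add: pair_simps)
  moreover have "p \<in> domPhi" using p by auto
  ultimately show ?thesis by blast
qed

text \<open>The domain has points strictly on both sides of the hyperplane of mass 1. The slope at
  \<open>q\<close> below it bounds the slopes above, and the slope at \<open>p\<close> above it
  bounds those below, so \<open>separating_slope\<close> applies.\<close>

lemma normalization_multiplier:
  assumes H: "convex_on domPhi H"
    and nonneg: "\<And>p. p \<in> domPhi \<Longrightarrow> \<langle>p, oneM\<rangle> = 1 \<Longrightarrow> H p \<ge> 0"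
  shows "\<exists>\<mu>. \<forall>p\<in>domPhi. \<mu> * (1 - \<langle>p, oneM\<rangle>) \<le> H p"
proof -
  obtain p where p: "p \<in> domPhi" "\<langle>p, oneM\<rangle> > 1"
    using ex_total_mass_beyond[of 1] by auto
  obtain q where q: "q \<in> domPhi" "\<langle>q, oneM\<rangle> < 1"
    using ex_total_mass_beyond[of "- 1"] by auto
  note slopes = slopes_ordered[OF H linear_pair_L nonneg]
  obtain a where a: "\<forall>x\<in>domPhi. a * (\<langle>x, oneM\<rangle> - 1) \<le> H x"
  proof -
    have "H q / (\<langle>q, oneM\<rangle> - 1) * (\<langle>x, oneM\<rangle> - 1) \<le> H x" if "x \<in> domPhi" "\<langle>x, oneM\<rangle> > 1" for x
      using slopes[OF _ _ that q] that by (simp add: pos_le_divide_eq)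
    moreover have "H p / (\<langle>p, oneM\<rangle> - 1) * (\<langle>x, oneM\<rangle> - 1) \<le> H x"
      if "x \<in> domPhi" "\<langle>x, oneM\<rangle> < 1" for x
      using slopes[OF _ _ p that] that by (simp add: neg_divide_le_eq)
    ultimately show ?thesis
      using separating_slope[OF H linear_pair_L nonneg] that by blast
  qed
  show ?thesis
    by (rule exI[of _ "- a"]) (use a in \<open>auto simp: algebra_simps\<close>)
qed

lemma ex_min_translation:
  assumes lam: "lam \<ge> 0"
  shows "\<exists>t. \<forall>t'. J \<epsilon> X (t, lam) \<le> J \<epsilon> X (t', lam)"
proof (cases "\<exists>t r. J \<epsilon> X (t, lam) \<le> ereal r")
  case False
  then have "J \<epsilon> X (t, lam) = \<infinity>" for t
    by (intro ereal_top) (meson linear)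
  then show ?thesis by simp
next
  case True
  define T where "T = {\<langle>p, X\<rangle> + lam * (\<epsilon> - phi p) | p. p \<in> domPhi \<and> \<langle>p, oneM\<rangle> = 1}"
  have T: "s \<le> r" if "s \<in> T" "J \<epsilon> X (t, lam) \<le> ereal r" for s t r
    using that by (auto simp: T_def dual_objective_le_iff)
  have ne: "T \<noteq> {}" unfolding T_def using oneL_in_dom pair_one_one by blast
  have bdd: "bdd_above T" using True T unfolding bdd_above_def by blast
  \<comment> \<open>\<open>H p\<close> is \<open>Sup T\<close> minus the Lagrangian without its mass
    term; a normalization multiplier for it attains the lower bound \<open>Sup T\<close>.\<close>
  define H where "H p = (- 1) * (\<langle>p, X\<rangle> - (Sup T - lam * \<epsilon>)) + lam * phi p" for p
  have "convex_on domPhi H"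
    unfolding H_def
    by (intro convex_on_add convex_on_affine linear_pair_L convex_on_cmul lam convex_on_phi
        convex_on_imp_convex[OF convex_on_phi])
  moreover have "H p \<ge> 0" if "p \<in> domPhi" "\<langle>p, oneM\<rangle> = 1" for p
  proof -
    have "\<langle>p, X\<rangle> + lam * (\<epsilon> - phi p) \<le> Sup T"
      using bdd that by (intro cSup_upper) (auto simp: T_def)
    then show ?thesis by (simp add: H_def algebra_simps)
  qed
  ultimately obtain \<mu> where \<mu>: "\<forall>p\<in>domPhi. \<mu> * (1 - \<langle>p, oneM\<rangle>) \<le> H p"
    using normalization_multiplier by blast
  have "J \<epsilon> X (\<mu>, lam) \<le> J \<epsilon> X (t', lam)" for t'
  proof (rule ereal_le_real)
    fix r assume "J \<epsilon> X (t', lam) \<le> ereal r"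
    then have "Sup T \<le> r" using T ne by (intro cSup_least) auto
    then show "J \<epsilon> X (\<mu>, lam) \<le> ereal r"
      using \<mu> by (force simp: dual_objective_le_iff H_def algebra_simps)
  qed
  then show ?thesis by blast
qed

section \<open>Attainment and scaling of the projected risk measure\<close>

lemma regret_attained:
  assumes lam: "lam > 0"
  shows "\<exists>t. \<forall>t'. regret P embM V lam X t \<le> regret P embM V lam X t'"
  \<comment> \<open>For \<open>\<epsilon> = 0\<close> the dual objective is the regret
    itself.\<close>
  using ex_min_translation[of lam 0 X] lam by (simp add: dual_objective_pos)

text \<open>The substitution of \<open>lam * s\<close> for the translation carries the infimum in
  \<open>risk\<close> to that of the regret.\<close>

lemma risk_scaled_eq_regret:
  assumes lam: "lam > 0" and t: "\<And>t'. regret P embM V lam X t \<le> regret P embM V lam X t'"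
  shows "risk_scaled P embM V lam X = regret P embM V lam X t"
proof -
  define g where "g s = ereal s + V (inverse lam *\<^sub>R X - const_elem P embM s)" for s
  have g: "regret P embM V lam X (lam * s) = ereal lam * g s" for s
  proof -
    have "inverse lam *\<^sub>R (X - const_elem P embM (lam * s)) = inverse lam *\<^sub>R X - const_elem P embM s"
      using lam by (simp add: const_elem_M[of s] const_elem_M[of "lam * s"] scaleR_diff_right)
    then show ?thesis
      using lam unfolding regret_def g_def
      by (cases "V (inverse lam *\<^sub>R X - const_elem P embM s)") (auto simp: algebra_simps)
  qed
  have t': "regret P embM V lam X t = ereal lam * g (t / lam)"
    using g[of "t / lam"] lam by simp
  have "g (t / lam) \<le> g s" for s
    using t[of "lam * s"] lam unfolding t' g by (simp add: ereal_mult_le_mult_iff)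
  then have "(INF s. g s) = g (t / lam)"
    by (intro antisym INF_lower INF_greatest) auto
  then show ?thesis
    unfolding t' risk_scaled_def risk_def g_def[symmetric] by simp
qed

section \<open>The risk measure as infimum of the dual objective, and strong duality\<close>

abbreviation R where "R \<equiv> risk_eps P embM V"

text \<open>Only \<open>lam = 0\<close> goes beyond the definition. Since \<open>phi\<close> is
  nonnegative, raising \<open>lam\<close> from 0 to \<open>l\<close> raises a bound on the objective
  by at most \<open>l * \<epsilon>\<close>, and \<open>l\<close> tends to 0.\<close>

lemma risk_eps_le:
  assumes lam: "lam \<ge> 0"
  shows "R \<epsilon> X \<le> J \<epsilon> X (\<mu>, lam)"
proof -
  have pos: "R \<epsilon> X \<le> J \<epsilon> X (\<mu>, l)" if l: "l > 0" for l
  proof -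
    obtain t where t: "\<And>t'. regret P embM V l X t \<le> regret P embM V l X t'"
      using regret_attained[OF l] by blast
    have "R \<epsilon> X \<le> ereal (l * \<epsilon>) + risk_scaled P embM V l X"
      unfolding risk_eps_def using l by (intro INF_lower) auto
    also have "\<dots> \<le> J \<epsilon> X (\<mu>, l)"
      unfolding dual_objective_pos[OF l] risk_scaled_eq_regret[OF l t]
      by (intro add_left_mono t)
    finally show ?thesis .
  qed
  show ?thesis
  proof (cases "lam = 0")
    case False
    with lam pos show ?thesis by simp
  next
    case True
    show ?thesis
      unfolding True
    proof (rule ereal_le_real)
      fix r assume r: "J \<epsilon> X (\<mu>, 0) \<le> ereal r"
      have "J \<epsilon> X (\<mu>, l) \<le> ereal (r + l * \<epsilon>)" if "l > 0" for l
        unfolding dual_objective_le_iff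
      proof
        fix p assume "p \<in> domPhi"
        then have "\<langle>p, X\<rangle> + \<mu> * (1 - \<langle>p, oneM\<rangle>) \<le> r"
          using r by (auto simp: dual_objective_le_iff)
        moreover have "l * phi p \<ge> 0" using that phi_nonneg by simp
        ultimately show "\<langle>p, X\<rangle> + \<mu> * (1 - \<langle>p, oneM\<rangle>) + l * (\<epsilon> - phi p) \<le> r + l * \<epsilon>"
          by (simp add: algebra_simps)
      qed
      with pos have le: "R \<epsilon> X \<le> ereal (r + l * \<epsilon>)" if "l > 0" for l
        using that order_trans by blast
      show "R \<epsilon> X \<le> ereal r"
      proof (rule ereal_le_epsilon2)
        fix e :: real assume e: "0 < e"
        \<comment> \<open>Chosen so that \<open>l * \<epsilon> \<le> e\<close>; the summand 1 avoids
          division by zero.\<close>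
        define l where "l = e / (\<bar>\<epsilon>\<bar> + 1)"
        have "l > 0" using e by (simp add: l_def)
        have "l * \<epsilon> \<le> l * (\<bar>\<epsilon>\<bar> + 1)" using \<open>l > 0\<close> by (intro mult_left_mono) auto
        also have "\<dots> = e" by (simp add: l_def)
        finally show "R \<epsilon> X \<le> ereal r + ereal e"
          using le[OF \<open>l > 0\<close>] by (auto intro: order_trans)
      qed
    qed
  qed
qed

lemma risk_eps_eq_INF: "R \<epsilon> X = (INF z\<in>UNIV \<times> {0..}. J \<epsilon> X z)"
proof (rule antisym)
  show "R \<epsilon> X \<le> (INF z\<in>UNIV \<times> {0..}. J \<epsilon> X z)"
    by (rule INF_greatest) (auto intro: risk_eps_le)
  show "(INF z\<in>UNIV \<times> {0..}. J \<epsilon> X z) \<le> R \<epsilon> X"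
    unfolding risk_eps_def
  proof (rule INF_greatest)
    fix lam :: real assume "lam \<in> {0<..}"
    then have lam: "lam > 0" by simp
    obtain t where t: "\<And>t'. regret P embM V lam X t \<le> regret P embM V lam X t'"
      using regret_attained[OF lam] by blast
    have "(INF z\<in>UNIV \<times> {0..}. J \<epsilon> X z) \<le> J \<epsilon> X (t, lam)"
      using lam by (intro INF_lower) auto
    then show "(INF z\<in>UNIV \<times> {0..}. J \<epsilon> X z) \<le> ereal (lam * \<epsilon>) + risk_scaled P embM V lam X"
      unfolding dual_objective_pos[OF lam] risk_scaled_eq_regret[OF lam t] .
  qed
qed

lemma pair_le_risk_eps:
  "p \<in> density_ball P embL embM V \<epsilon> \<Longrightarrow> ereal \<langle>p, X\<rangle> \<le> R \<epsilon> X"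
  unfolding risk_eps_eq_INF by (rule INF_greatest) (auto intro: weak_duality)

lemma oneL_in_density_ball: "\<epsilon> \<ge> 0 \<Longrightarrow> oneL \<in> density_ball P embL embM V \<epsilon>"
  by (simp add: density_ball_iff pair_one_one divergence_oneL)

lemma risk_eps_not_minf: "\<epsilon> \<ge> 0 \<Longrightarrow> R \<epsilon> X \<noteq> -\<infinity>"
  using pair_le_risk_eps[OF oneL_in_density_ball, of \<epsilon> X] by auto

text \<open>The multipliers are found in turn: \<open>lam\<close> on the slice of mass 1, where
  \<open>oneL\<close> is a Slater point because its divergence 0 is below \<open>\<epsilon>\<close>,
  and then \<open>\<mu>\<close> on the whole domain, with the term of \<open>lam\<close> included in
  the convex function.\<close>

lemma strong_duality:
  assumes \<epsilon>: "\<epsilon> > 0"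
  shows "\<exists>\<mu> lam. lam \<ge> 0 \<and> J \<epsilon> X (\<mu>, lam) \<le> (SUP p\<in>density_ball P embL embM V \<epsilon>. ereal \<langle>p, X\<rangle>)"
proof (cases "SUP p\<in>density_ball P embL embM V \<epsilon>. ereal \<langle>p, X\<rangle>")
  case MInf
  then show ?thesis
    using SUP_upper[OF oneL_in_density_ball, of \<epsilon> "\<lambda>p. ereal \<langle>p, X\<rangle>"] \<epsilon> by simp
next
  case PInf
  then show ?thesis by auto
next
  case (real v)
  have v: "\<langle>p, X\<rangle> \<le> v" if "p \<in> domPhi" "\<langle>p, oneM\<rangle> = 1" "phi p \<le> \<epsilon>" for p
  proof -
    have "p \<in> density_ball P embL embM V \<epsilon>"
      using that divergence_real[OF that(1)] by (simp add: density_ball_iff)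
    then have "ereal \<langle>p, X\<rangle> \<le> ereal v" unfolding real[symmetric] by (rule SUP_upper)
    then show ?thesis by simp
  qed
  define S where "S = {p \<in> domPhi. \<langle>p, oneM\<rangle> = 1}"
  have domPhi: "convex domPhi" using convex_on_phi by (rule convex_on_imp_convex)
  have S: "convex S"
    using domPhi unfolding S_def convex_def by (auto simp: pair_simps)
  have "\<exists>lam\<ge>0. \<forall>p\<in>S. (- 1) * (\<langle>p, X\<rangle> - v) + lam * (phi p + (- \<epsilon>)) \<ge> 0"
  proof (rule slater_multiplier)
    show "convex_on S (\<lambda>p. (- 1) * (\<langle>p, X\<rangle> - v))"
      by (intro convex_on_affine linear_pair_L S)
    show "convex_on S (\<lambda>p. phi p + (- \<epsilon>))"
      by (intro convex_on_add convex_on_const[THEN iffD2] S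
          convex_on_subset[OF convex_on_phi]) (auto simp: S_def)
    show "oneL \<in> S" using oneL_in_dom by (simp add: S_def pair_one_one)
    show "phi oneL + - \<epsilon> < 0" using \<epsilon> by (simp add: phi_def divergence_oneL)
  qed (use v in \<open>auto simp: S_def\<close>)
  then obtain lam where lam: "lam \<ge> 0"
    "\<And>p. p \<in> S \<Longrightarrow> (- 1) * (\<langle>p, X\<rangle> - v) + lam * (phi p + (- \<epsilon>)) \<ge> 0"
    by blast
  have "convex_on domPhi (\<lambda>p. (- 1) * (\<langle>p, X\<rangle> - v) + lam * (phi p + (- \<epsilon>)))"
    by (intro convex_on_add convex_on_affine linear_pair_L convex_on_cmul lam(1) convex_on_phi
        convex_on_const[THEN iffD2] domPhi)
  then obtain \<mu> where
    "\<forall>p\<in>domPhi. \<mu> * (1 - \<langle>p, oneM\<rangle>) \<le> (- 1) * (\<langle>p, X\<rangle> - v) + lam * (phi p + (- \<epsilon>))"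
    using normalization_multiplier[of "\<lambda>p. (- 1) * (\<langle>p, X\<rangle> - v) + lam * (phi p + (- \<epsilon>))"] lam(2)
    by (auto simp: S_def)
  then have "J \<epsilon> X (\<mu>, lam) \<le> ereal v"
    by (auto simp: dual_objective_le_iff algebra_simps)
  then show ?thesis using real lam(1) by auto
qed

section \<open>Variational densities\<close>

lemma variational_iff:
  assumes dual: "R \<epsilon> X = (SUP p\<in>density_ball P embL embM V \<epsilon>. ereal \<langle>p, X\<rangle>)"
  shows "variational_density P embL embM V \<epsilon> X p \<longleftrightarrow>
    p \<in> density_ball P embL embM V \<epsilon> \<and> R \<epsilon> X = ereal \<langle>p, X\<rangle>"
proof (intro iffI conjI)
  assume *: "variational_density P embL embM V \<epsilon> X p"
  then show p: "p \<in> density_ball P embL embM V \<epsilon>"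
    by (simp add: variational_density_def is_arg_max_def)
  show "R \<epsilon> X = ereal \<langle>p, X\<rangle>"
    unfolding dual using * p
    by (intro antisym SUP_least SUP_upper)
      (auto simp: variational_density_def is_arg_max_def not_less)
next
  assume *: "p \<in> density_ball P embL embM V \<epsilon> \<and> R \<epsilon> X = ereal \<langle>p, X\<rangle>"
  then have "\<langle>q, X\<rangle> \<le> \<langle>p, X\<rangle>" if "q \<in> density_ball P embL embM V \<epsilon>" for q
    using pair_le_risk_eps[OF that, of X] by simp
  then show "variational_density P embL embM V \<epsilon> X p"
    using * by (auto simp: variational_density_def is_arg_max_def not_less)
qed

text \<open>This instance of positive homogeneity allows subgradients at \<open>X\<close> to be
  tested at \<open>2 *\<^sub>R X\<close>.\<close>

lemma dual_objective_double:
  assumes "J \<epsilon> X (\<mu>, lam) \<le> ereal r"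
  shows "J \<epsilon> (2 *\<^sub>R X) (2 * \<mu>, 2 * lam) \<le> ereal (2 * r)"
  unfolding dual_objective_le_iff
proof
  fix p assume "p \<in> domPhi"
  then have "\<langle>p, X\<rangle> + \<mu> * (1 - \<langle>p, oneM\<rangle>) + lam * (\<epsilon> - phi p) \<le> r"
    using assms by (simp add: dual_objective_le_iff)
  then have "2 * (\<langle>p, X\<rangle> + \<mu> * (1 - \<langle>p, oneM\<rangle>) + lam * (\<epsilon> - phi p)) \<le> 2 * r"
    by simp
  then show "\<langle>p, 2 *\<^sub>R X\<rangle> + 2 * \<mu> * (1 - \<langle>p, oneM\<rangle>) + 2 * lam * (\<epsilon> - phi p) \<le> 2 * r"
    by (simp only: pair_simps distrib_left mult.assoc real_scaleR_def)
qed

text \<open>Test points recover all properties from a subgradient: \<open>0\<close> and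
  \<open>2 *\<^sub>R X\<close> give the value \<open>\<langle>p, X\<rangle>\<close>, the constants 1
  and -1 the normalization, and arbitrary \<open>Y\<close> with
  \<open>R \<epsilon> Y \<le> \<epsilon> + V Y\<close> the bound on the divergence.\<close>

lemma to_dual_in_subdifferential_risk_eps_iff:
  assumes \<epsilon>: "\<epsilon> \<ge> 0"
  shows "to_dual P embL embM p \<in> subdifferential (R \<epsilon>) X \<longleftrightarrow>
    p \<in> density_ball P embL embM V \<epsilon> \<and> R \<epsilon> X = ereal \<langle>p, X\<rangle>"
proof
  assume *: "p \<in> density_ball P embL embM V \<epsilon> \<and> R \<epsilon> X = ereal \<langle>p, X\<rangle>"
  have "ereal \<langle>p, Y - X\<rangle> \<le> R \<epsilon> Y - R \<epsilon> X" for Y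
  proof -
    have "ereal \<langle>p, Y\<rangle> \<le> R \<epsilon> Y" using * pair_le_risk_eps by blast
    then show ?thesis using * by (cases "R \<epsilon> Y") (auto simp: pair_simps)
  qed
  then show "to_dual P embL embM p \<in> subdifferential (R \<epsilon>) X"
    by (simp add: subdifferential_def to_dual_apply)
next
  assume "to_dual P embL embM p \<in> subdifferential (R \<epsilon>) X"
  then have sub: "ereal \<langle>p, Y - X\<rangle> \<le> R \<epsilon> Y - R \<epsilon> X" for Y
    by (simp add: subdifferential_def to_dual_apply)
  \<comment> \<open>At \<open>\<mu> = t\<close> and \<open>lam = 0\<close> the Lagrangian of the
    constant \<open>t\<close> equals \<open>t\<close> for every \<open>p\<close>.\<close>
  have const: "R \<epsilon> (t *\<^sub>R oneM) \<le> ereal t" for t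
    using risk_eps_le[of 0 \<epsilon> "t *\<^sub>R oneM" t]
    by (rule order_trans) (auto simp: dual_objective_le_iff pair_simps algebra_simps)
  \<comment> \<open>An infinite value at \<open>X\<close> would make the right side of
    \<open>sub\<close> at \<open>0\<close> equal to \<open>-\<infinity>\<close>, because
    \<open>R \<epsilon> 0 \<le> 0\<close>.\<close>
  obtain \<rho> where \<rho>: "R \<epsilon> X = ereal \<rho>"
  proof (cases "R \<epsilon> X")
    case PInf
    then show ?thesis
      using sub[of 0] const[of 0] by (cases "R \<epsilon> 0") auto
  qed (use risk_eps_not_minf[OF \<epsilon>] that in auto)
  have sub': "\<langle>p, Y\<rangle> - \<langle>p, X\<rangle> + \<rho> \<le> r" if "R \<epsilon> Y \<le> ereal r" for Y r
    using sub[of Y] that \<rho> by (cases "R \<epsilon> Y") (auto simp: pair_simps)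
  have "\<rho> \<le> \<langle>p, X\<rangle>"
    using sub'[of 0 0] const[of 0] by (simp add: pair_simps)
  moreover have "\<langle>p, X\<rangle> \<le> \<rho>"
  proof (rule field_le_epsilon)
    fix e :: real assume "e > 0"
    then have "(INF z\<in>UNIV \<times> {0..}. J \<epsilon> X z) < ereal (\<rho> + e / 2)"
      using \<rho> by (simp add: risk_eps_eq_INF[symmetric])
    then obtain \<mu> lam where "lam \<ge> 0" "J \<epsilon> X (\<mu>, lam) \<le> ereal (\<rho> + e / 2)"
      by (auto simp: INF_less_iff dest!: less_imp_le)
    then have "R \<epsilon> (2 *\<^sub>R X) \<le> ereal (2 * (\<rho> + e / 2))"
      using risk_eps_le[of "2 * lam"] dual_objective_double
        by (meson order_trans mult_nonneg_nonneg zero_le_numeral)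
    then show "\<langle>p, X\<rangle> \<le> \<rho> + e" using sub' by (fastforce simp: pair_simps)
  qed
  ultimately have eq: "\<rho> = \<langle>p, X\<rangle>" by simp
  then have le: "\<langle>p, Y\<rangle> \<le> r" if "R \<epsilon> Y \<le> ereal r" for Y r
    using sub'[OF that] by simp
  have "\<langle>p, oneM\<rangle> = 1"
    using le[OF const[of 1]] le[OF const[of "- 1"]] by (simp add: pair_simps)
  moreover have "ereal \<langle>p, Y\<rangle> \<le> ereal \<epsilon> + V Y" for Y
  proof (cases "V Y")
    case (real w)
    \<comment> \<open>Without translation and with \<open>lam = 1\<close>, the dual objective is
      bounded by \<open>\<epsilon> + V Y\<close>.\<close>
    have "R \<epsilon> Y \<le> J \<epsilon> Y (0, 1)" by (rule risk_eps_le) simp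
    also have "\<dots> \<le> ereal (\<epsilon> + w)"
      using V_le_iff[of Y w] real by (auto simp: dual_objective_le_iff algebra_simps)
    finally show ?thesis using le real by simp
  qed (use V_not_minf[of Y] in auto)
  ultimately show "p \<in> density_ball P embL embM V \<epsilon> \<and> R \<epsilon> X = ereal \<langle>p, X\<rangle>"
    using \<rho> eq by (simp add: density_ball_iff divergence_le_iff)
qed

text \<open>Membership amounts to equality in the Fenchel-Young inequality; testing at 0, where
  \<open>V\<close> vanishes, excludes an infinite value at \<open>Y\<close>.\<close>

lemma to_dual_in_subdifferential_V_iff:
  "to_dual P embL embM p \<in> subdifferential V Y \<longleftrightarrow>
    p \<in> domPhi \<and> V Y = ereal (\<langle>p, Y\<rangle> - phi p)"
proof
  assume *: "p \<in> domPhi \<and> V Y = ereal (\<langle>p, Y\<rangle> - phi p)"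
  have "ereal \<langle>p, Z - Y\<rangle> \<le> V Z - V Y" for Z
    using * fenchel_young[of p Z] by (cases "V Z") (auto simp: pair_simps)
  then show "to_dual P embL embM p \<in> subdifferential V Y"
    by (simp add: subdifferential_def to_dual_apply)
next
  assume "to_dual P embL embM p \<in> subdifferential V Y"
  then have sub: "ereal \<langle>p, Z - Y\<rangle> \<le> V Z - V Y" for Z
    by (simp add: subdifferential_def to_dual_apply)
  obtain w where w: "V Y = ereal w"
    using sub[of 0] V_not_minf[of Y] by (cases "V Y") (auto simp: V_zero)
  have "ereal \<langle>p, Z\<rangle> \<le> ereal (\<langle>p, Y\<rangle> - w) + V Z" for Z
    using sub[of Z] w V_not_minf[of Z] by (cases "V Z") (auto simp: pair_simps)
  then have le: "Phi p \<le> ereal (\<langle>p, Y\<rangle> - w)" by (simp add: divergence_le_iff)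
  then have dom: "p \<in> domPhi" by auto
  then have "phi p = \<langle>p, Y\<rangle> - w"
    using le divergence_real[OF dom] fenchel_young[OF dom, of Y] w by auto
  then show "p \<in> domPhi \<and> V Y = ereal (\<langle>p, Y\<rangle> - phi p)"
    using dom w by simp
qed

text \<open>Optimality of \<open>p\<close> gives
  \<open>\<epsilon> + V Y = \<langle>p, Y\<rangle>\<close> at the rescaled point \<open>Y\<close>;
  with Fenchel-Young and \<open>phi p \<le> \<epsilon>\<close> this forces
  \<open>phi p = \<epsilon>\<close> (complementary slackness) and a subgradient. Conversely, a
  subgradient of mass 1 has \<open>\<langle>p, X\<rangle>\<close> equal to the optimal value plus
  \<open>lam * (phi p - \<epsilon>)\<close>, which explains the condition on
  \<open>Phi p\<close>.\<close>

lemma variational_densities: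
  assumes dual: "R \<epsilon> X = (SUP p\<in>density_ball P embL embM V \<epsilon>. ereal \<langle>p, X\<rangle>)"
    and sol: "J \<epsilon> X (\<mu>, lam) = R \<epsilon> X" and lam: "lam > 0"
  shows "variational_density P embL embM V \<epsilon> X p \<longleftrightarrow>
    to_dual P embL embM p \<in> subdifferential V (inverse lam *\<^sub>R (X - const_elem P embM \<mu>)) \<and>
    expect P embL p = 1 \<and> Phi p = ereal \<epsilon>"
proof -
  define Y where "Y = inverse lam *\<^sub>R (X - const_elem P embM \<mu>)"
  have J: "J \<epsilon> X (\<mu>, lam) = ereal (lam * \<epsilon> + \<mu>) + ereal lam * V Y"
    using lam by (simp add: dual_objective_pos regret_def Y_def add.assoc[symmetric])
  have Y: "\<langle>p, X\<rangle> = lam * \<langle>p, Y\<rangle> + \<mu> * \<langle>p, oneM\<rangle>"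
    using lam by (simp add: Y_def const_elem_M[of \<mu>] pair_simps mult.assoc[symmetric])
  show ?thesis
    unfolding variational_iff[OF dual] to_dual_in_subdifferential_V_iff Y_def[symmetric]
      pair_oneM[symmetric]
  proof
    assume *: "p \<in> density_ball P embL embM V \<epsilon> \<and> R \<epsilon> X = ereal \<langle>p, X\<rangle>"
    then have one: "\<langle>p, oneM\<rangle> = 1" and le: "Phi p \<le> ereal \<epsilon>" by (auto simp: density_ball_iff)
    then have dom: "p \<in> domPhi" by auto
    obtain w where w: "V Y = ereal w"
      using * sol lam V_not_minf[of Y] unfolding J by (cases "V Y") auto
    have "lam * \<epsilon> + \<mu> + lam * w = lam * \<langle>p, Y\<rangle> + \<mu>"
      using * sol Y one w unfolding J by simp
    then have "lam * (\<epsilon> + w) = lam * \<langle>p, Y\<rangle>" by (simp add: algebra_simps)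
    then have eq: "\<epsilon> + w = \<langle>p, Y\<rangle>" using lam by simp
    have "phi p = \<epsilon>"
      using le divergence_real[OF dom] fenchel_young[OF dom, of Y] w eq by auto
    then show "(p \<in> domPhi \<and> V Y = ereal (\<langle>p, Y\<rangle> - phi p)) \<and> \<langle>p, oneM\<rangle> = 1 \<and> Phi p = ereal \<epsilon>"
      using dom divergence_real[OF dom] w eq one by auto
  next
    assume *: "(p \<in> domPhi \<and> V Y = ereal (\<langle>p, Y\<rangle> - phi p)) \<and> \<langle>p, oneM\<rangle> = 1 \<and> Phi p = ereal \<epsilon>"
    then have "phi p = \<epsilon>" by (simp add: phi_def)
    with * have "R \<epsilon> X = ereal (lam * \<epsilon> + \<mu> + lam * (\<langle>p, Y\<rangle> - \<epsilon>))"
      using sol unfolding J by simp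
    also have "\<dots> = ereal \<langle>p, X\<rangle>" using * Y by (simp add: algebra_simps)
    finally show "p \<in> density_ball P embL embM V \<epsilon> \<and> R \<epsilon> X = ereal \<langle>p, X\<rangle>"
      using * by (simp add: density_ball_iff)
  qed
qed

end

text \<open>For \<open>\<epsilon> > 0\<close> the density 1 is strictly feasible, which yields
  strong duality and optimal multipliers. For \<open>\<epsilon> = 0\<close> the description of the
  variational densities is conditional on equality in weak duality.\<close>

theorem theorem12:
  fixes P :: "'a measure"
    and embL :: "'l::banach \<Rightarrow> 'a \<Rightarrow> real"
    and embM :: "'m::banach \<Rightarrow> 'a \<Rightarrow> real"
    and V :: "'m \<Rightarrow> ereal"
    and \<epsilon> :: real
    and m :: "'a \<Rightarrow> 'y \<Rightarrow> real" and y :: "nat \<Rightarrow> 'y" and N :: nat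
    and MN :: 'm
  assumes V: "risk_averse_disutility P embL embM V"
    and eps: "\<epsilon> \<ge> 0"
    and N: "N \<ge> 1"
    and MN: "AE \<theta> in P. embM MN \<theta> = payoff m y N \<theta>"
  defines "\<Phi> \<equiv> divergence P embL embM V"
    and "D \<equiv> density_ball P embL embM V \<epsilon>"
    and "E \<equiv> pairing P embL embM"
    and "R \<equiv> risk_eps P embM V \<epsilon>"
    and "J \<equiv> dual_objective P embL embM V \<epsilon> MN"
    and "solves \<equiv> is_arg_min (dual_objective P embL embM V \<epsilon> MN) (\<lambda>(\<mu>, lam). lam \<ge> 0)"
    and "variational \<equiv> variational_density P embL embM V \<epsilon> MN"
  shows
    "(\<forall>X. \<exists>t. is_arg_min (\<lambda>t. ereal t + V (X - const_elem P embM t)) (\<lambda>_. True) t) \<and>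
     (\<forall>X. \<forall>lam>0. \<exists>t. is_arg_min (regret P embM V lam X) (\<lambda>_. True) t \<and>
        risk_scaled P embM V lam X = regret P embM V lam X t) \<and>
     R MN = (INF (\<mu>, lam) \<in> UNIV \<times> {0..}. J (\<mu>, lam)) \<and>
     (SUP p\<in>D. ereal (E p MN)) \<le> R MN \<and>
     (\<epsilon> > 0 \<longrightarrow>
        R MN = (SUP p\<in>D. ereal (E p MN)) \<and>
        (\<exists>\<mu> lam. solves (\<mu>, lam) \<and> R MN = J (\<mu>, lam))) \<and>
     (\<epsilon> > 0 \<or> R MN = (SUP p\<in>D. ereal (E p MN)) \<longrightarrow>
        ((\<exists>p. variational p) \<longleftrightarrow>
           subdifferential R MN \<inter> range (to_dual P embL embM) \<noteq> {}) \<and>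
        (\<forall>\<mu> lam. solves (\<mu>, lam) \<and> lam > 0 \<longrightarrow>
           {p. variational p} =
           {p. to_dual P embL embM p \<in> subdifferential V (inverse lam *\<^sub>R (MN - const_elem P embM \<mu>)) \<and>
               expect P embL p = 1} \<inter> {p. \<Phi> p = ereal \<epsilon>}))"
proof -
  interpret risk_averse_disutility P embL embM V by (rule V)
  have regret_one: "regret P embM V 1 = (\<lambda>X t. ereal t + V (X - const_elem P embM t))"
    by (simp add: regret_def fun_eq_iff one_ereal_def[symmetric])
  have part2: "\<exists>t. is_arg_min (regret P embM V lam X) (\<lambda>_. True) t \<and>
      risk_scaled P embM V lam X = regret P embM V lam X t" if "lam > 0" for lam X
    using regret_attained[OF that, of X] risk_scaled_eq_regret[OF that, of X]
    by (metis is_arg_min_linorder)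
  have part1: "\<exists>t. is_arg_min (\<lambda>t. ereal t + V (X - const_elem P embM t)) (\<lambda>_. True) t" for X
    using part2[of 1 X] by (auto simp: regret_one)
  have inf: "R MN = (INF (\<mu>, lam) \<in> UNIV \<times> {0..}. J (\<mu>, lam))"
    unfolding R_def J_def risk_eps_eq_INF by simp
  have weak: "(SUP p\<in>D. ereal (E p MN)) \<le> R MN"
    unfolding R_def D_def E_def by (intro SUP_least pair_le_risk_eps)
  have strong: "R MN = (SUP p\<in>D. ereal (E p MN)) \<and> (\<exists>\<mu> lam. solves (\<mu>, lam) \<and> R MN = J (\<mu>, lam))"
    if pos: "\<epsilon> > 0"
  proof -
    obtain \<mu> lam where lam: "lam \<ge> 0" and le: "J (\<mu>, lam) \<le> (SUP p\<in>D. ereal (E p MN))"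
      using strong_duality[OF pos, of MN] unfolding J_def D_def E_def by blast
    have ge: "R MN \<le> J (\<mu>', lam')" if "lam' \<ge> 0" for \<mu>' lam'
      unfolding R_def J_def using that by (rule risk_eps_le)
    \<comment> \<open>Weak duality, \<open>ge\<close> and \<open>le\<close> form a cycle of
      inequalities through the supremum, \<open>R MN\<close> and \<open>J\<close>.\<close>
    have eq: "R MN = (SUP p\<in>D. ereal (E p MN))" "R MN = J (\<mu>, lam)"
      using ge[OF lam, of \<mu>] le weak by auto
    then have "solves (\<mu>, lam)"
      using ge lam unfolding solves_def J_def[symmetric] by (auto simp: is_arg_min_linorder)
    with eq show ?thesis by blast
  qed
  have dual: "R MN = (SUP p\<in>D. ereal (E p MN))"
    if "\<epsilon> > 0 \<or> R MN = (SUP p\<in>D. ereal (E p MN))"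
    using that strong by blast
  have exist: "(\<exists>p. variational p) \<longleftrightarrow> subdifferential R MN \<inter> range (to_dual P embL embM) \<noteq> {}"
    if "\<epsilon> > 0 \<or> R MN = (SUP p\<in>D. ereal (E p MN))"
    using variational_iff[OF dual[OF that, unfolded R_def D_def E_def]]
      to_dual_in_subdifferential_risk_eps_iff[OF eps, of _ MN]
    unfolding variational_def R_def by blast
  have sols: "{p. variational p} =
      {p. to_dual P embL embM p \<in> subdifferential V (inverse lam *\<^sub>R (MN - const_elem P embM \<mu>)) \<and>
          expect P embL p = 1} \<inter> {p. \<Phi> p = ereal \<epsilon>}"
    if *: "\<epsilon> > 0 \<or> R MN = (SUP p\<in>D. ereal (E p MN))" and sol: "solves (\<mu>, lam)" and lam: "lam > 0"
    for \<mu> lam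
  proof -
    have "J (\<mu>, lam) \<le> R MN"
      unfolding inf using sol unfolding solves_def J_def[symmetric]
      by (intro INF_greatest) (auto simp: is_arg_min_linorder)
    moreover have "R MN \<le> J (\<mu>, lam)"
      unfolding R_def J_def using lam by (intro risk_eps_le) simp
    ultimately have "J (\<mu>, lam) = R MN" by simp
    then show ?thesis
      using variational_densities[OF dual[OF *, unfolded R_def D_def E_def] _ lam, of \<mu>]
      unfolding variational_def R_def J_def \<Phi>_def by auto
  qed
  show ?thesis
    using part1 part2 inf weak strong exist sols by blast
qed

end
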